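(* Let $H$ and $G$ be two locally compact second countable compactly generated unimodular groups and let $p\in[1,\infty)$. Suppose there exists an $L^p$-measure subgroup coupling from $H$ to $G$ that is coarsely $m$-to-$1$ (for some $m>0$). Then $$j_{p,G}\preccurlyeq j_{p,H}.$$
   Context: Conventions. Fix compact symmetric generating subsets $S_H\subset H$, $S_G\subset G$, with word lengths $|\cdot|_H,|\cdot|_G$, and left-invariant proper metrics $d_H,d_G$ compatible with the topologies and quasi-isometric to the word metrics. Haar measures $\lambda_H,\lambda_G$ are fixed. A scale $s>0$ is fixed once and for all. Smooth actions. A measurable space is countably separated if there is a countable family of measurable sets separating its points. A Borel action of a locally compact second countable group on a standard Borel space $\Omega$ is smooth if the quotient, with the quotient measurable structure, is countably separated; then there is a Borel section of the quotient map, whose image is called a fundamental domain. Measure subgroup coupling. A measure subgroup coupling from $H$ to $G$ is a standard Borel space $\Omega$ with a nonzero measure $\mu$ and two commuting, smooth, free, $\mu$-preserving Borel actions of $H$ and $G$ (both denoted $*$) with fundamental domains $\mathcal F_H,\mathcal F_G$, such that there exist a $\sigma$-finite measure $\nu_H$ on $\mathcal F_H$ and a finite measure $\nu_G$ on $\mathcal F_G$ for which the maps $i_G\colon (G\times\mathcal F_G,\lambda_G\otimes\nu_G)\to(\Omega,\mu)$, $(g,x)\mapsto g*x$, and $i_H\colon (H\times\mathcal F_H,\lambda_H\otimes\nu_H)\to(\Omega,\mu)$, $(h,x)\mapsto h*x$, are isomorphisms of measured spaces. Cocycle. For $h\in H$, $x\in\mathcal F_G$, let $h\cdot x\in\mathcal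 F_G$ be the unique point of $\mathcal F_G$ in the $G$-orbit of $h*x$, and let $c_G(h,x)\in G$ be defined by $h*x=c_G(h,x)*(h\cdot x)$. The coupling is an $L^p$-measure subgroup coupling if $\sup_{h\in S_H}\big\||c_G(h,\cdot)|_G\big\|_{L^p(\mathcal F_G,\nu_G)}<\infty$. It is coarsely $m$-to-$1$ if for every $x\in\mathcal F_G$ the map $c_x\colon H\to G$, $c_x(h)=c_G(h^{-1},x)$, is such that the preimage of any ball of radius $3$ in $G$ can be covered by at most $m$ balls of radius $s$ in $H$. Isoperimetric profile. For $f\in L^p(G,\lambda_G)$ put $\|\nabla_G^r f\|_p=\sup_{t\in S_G}\|f-\rho(t)f\|_p$, where $(\rho(t)f)(g)=f(gt)$. For $A\subset G$ of finite measure, $J_{p,G}(A)=\sup\|f\|_p/\|\nabla_G^r f\|_p\in[0,+\infty]$, the supremum being over nonzero $f\in L^p(G)$ vanishing outside $A$ (ratio $+\infty$ if the gradient vanishes), and $j_{p,G}(v)=\sup_{\lambda_G(A)\le v}J_{p,G}(A)$. (Since $G$ is unimodular, the left regular representation gives the same profile.) Similarly for $H$. For nondecreasing functions $a,b$, $a\preccurlyeq b$ means there is $C>0$ with $a(v)=O(b(Cv))$ as $v\to\infty$. *)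

theory Defs
  imports "HOL-Analysis.Analysis"
begin

text \<open>
  Groups are types of class \<open>topological_group_add\<close>. That class does not assume commutativity:
  \<open>g + h\<close> is the product \<open>gh\<close>, \<open>- g\<close> is the inverse and \<open>0\<close> is the identity. The order of the
  summands therefore matters everywhere below.
\<close>

subsection \<open>Lengths, metrics and Haar measure on a group\<close>

definition compact_symmetric_generating :: "'g::topological_group_add set \<Rightarrow> bool" where
  "compact_symmetric_generating S \<longleftrightarrow>
     compact S \<and> uminus ` S = S \<and> (\<forall>g. \<exists>w. set w \<subseteq> S \<and> sum_list w = g)"

definition word_length :: "'g::group_add set \<Rightarrow> 'g \<Rightarrow> nat" where
  "word_length S g = (LEAST n. \<exists>w. length w = n \<and> set w \<subseteq> S \<and> sum_list w = g)"

text \<open>The word metric is \<open>\<bar>x\<inverse> y\<bar>\<close>; the last clause says that the identity map is a quasi-isometry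
  from the given metric to it.\<close>

definition adapted_metric :: "'g::topological_group_add set \<Rightarrow> 'g metric \<Rightarrow> bool" where
  "adapted_metric S d \<longleftrightarrow>
     mspace d = UNIV \<and>
     mtopology_of d = euclidean \<and>
     (\<forall>g x y. mdist d (g + x) (g + y) = mdist d x y) \<and>
     (\<forall>x r. compact (mcball_of d x r)) \<and>
     (\<exists>L\<ge>1. \<exists>C\<ge>0. \<forall>x y.
        mdist d x y / L - C \<le> real (word_length S (- x + y)) \<and>
        real (word_length S (- x + y)) \<le> L * mdist d x y + C)"

text \<open>Left Haar measures. On a locally compact second countable Hausdorff group every Borel measure
  that is finite on compact sets is regular, so regularity is not listed.\<close>

definition haar_measure :: "'g::topological_group_add measure \<Rightarrow> bool" where
  "haar_measure lam \<longleftrightarrow>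
     sets lam = sets borel \<and>
     emeasure lam UNIV \<noteq> 0 \<and>
     (\<forall>K. compact K \<longrightarrow> emeasure lam K < \<infinity>) \<and>
     (\<forall>g. distr lam borel (\<lambda>x. g + x) = lam)"

definition unimodular :: "'g::topological_group_add itself \<Rightarrow> bool" where
  "unimodular _ \<longleftrightarrow>
     (\<forall>lam::'g measure. haar_measure lam \<longrightarrow> (\<forall>g. distr lam borel (\<lambda>x. x + g) = lam))"

subsection \<open>Isoperimetric profile\<close>

definition Lp_norm :: "real \<Rightarrow> 'a measure \<Rightarrow> ('a \<Rightarrow> real) \<Rightarrow> ennreal" where
  "Lp_norm p M f =
     (let I = \<integral>\<^sup>+ x. ennreal (\<bar>f x\<bar> powr p) \<partial>M
      in if I = \<infinity> then \<infinity> else ennreal (enn2real I powr (1 / p)))"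

definition Lp_space :: "real \<Rightarrow> 'a measure \<Rightarrow> ('a \<Rightarrow> real) set" where
  "Lp_space p M = {f \<in> borel_measurable M. Lp_norm p M f < \<infinity>}"

definition right_gradient_norm ::
  "real \<Rightarrow> 'g::topological_group_add set \<Rightarrow> 'g measure \<Rightarrow> ('g \<Rightarrow> real) \<Rightarrow> ennreal" where
  "right_gradient_norm p S lam f = (SUP t\<in>S. Lp_norm p lam (\<lambda>g. f g - f (g + t)))"

definition isop_J ::
  "real \<Rightarrow> 'g::topological_group_add set \<Rightarrow> 'g measure \<Rightarrow> 'g set \<Rightarrow> ennreal" where
  "isop_J p S lam A =
     (SUP f \<in> {f \<in> Lp_space p lam. \<not> (AE x in lam. f x = 0) \<and> (AE x in lam. x \<notin> A \<longrightarrow> f x = 0)}.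
        if right_gradient_norm p S lam f = 0 then \<infinity>
        else Lp_norm p lam f / right_gradient_norm p S lam f)"

definition isop_profile ::
  "real \<Rightarrow> 'g::topological_group_add set \<Rightarrow> 'g measure \<Rightarrow> real \<Rightarrow> ennreal" where
  "isop_profile p S lam v = (SUP A \<in> {A \<in> sets lam. emeasure lam A \<le> ennreal v}. isop_J p S lam A)"

definition asymp_dominated :: "(real \<Rightarrow> ennreal) \<Rightarrow> (real \<Rightarrow> ennreal) \<Rightarrow> bool" where
  "asymp_dominated a b \<longleftrightarrow>
     (\<exists>C>0. \<exists>K>0. \<forall>\<^sub>F v in at_top. a v \<le> ennreal K * b (C * v))"

subsection \<open>Smooth actions\<close>

definition standard_borel :: "'a measure \<Rightarrow> bool" where
  "standard_borel M \<longleftrightarrow>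
     (\<exists>T. topspace T = space M \<and> completely_metrizable_space T \<and> second_countable T \<and>
          sets M = sigma_sets (space M) {U. openin T U})"

definition countably_separated :: "'a measure \<Rightarrow> bool" where
  "countably_separated M \<longleftrightarrow>
     (\<exists>\<A>. countable \<A> \<and> \<A> \<subseteq> sets M \<and>
        (\<forall>x\<in>space M. \<forall>y\<in>space M. x \<noteq> y \<longrightarrow> (\<exists>A\<in>\<A>. x \<in> A \<longleftrightarrow> y \<notin> A)))"

definition borel_action :: "'a measure \<Rightarrow> ('g::topological_group_add \<Rightarrow> 'a \<Rightarrow> 'a) \<Rightarrow> bool" where
  "borel_action M act \<longleftrightarrow>
     (\<lambda>(g, x). act g x) \<in> borel \<Otimes>\<^sub>M M \<rightarrow>\<^sub>M M \<and>
     (\<forall>x\<in>space M. act 0 x = x) \<and>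
     (\<forall>g h. \<forall>x\<in>space M. act (g + h) x = act g (act h x))"

definition orbit :: "('g \<Rightarrow> 'a \<Rightarrow> 'a) \<Rightarrow> 'a \<Rightarrow> 'a set" where
  "orbit act x = range (\<lambda>g. act g x)"

text \<open>A set of orbits is measurable iff its preimage in the space, that is its union, is. These sets
  already form a \<open>\<sigma>\<close>-algebra.\<close>

definition orbit_space :: "'a measure \<Rightarrow> ('g \<Rightarrow> 'a \<Rightarrow> 'a) \<Rightarrow> 'a set measure" where
  "orbit_space M act =
     sigma (orbit act ` space M) {B. B \<subseteq> orbit act ` space M \<and> \<Union>B \<in> sets M}"

definition smooth_action :: "'a measure \<Rightarrow> ('g::topological_group_add \<Rightarrow> 'a \<Rightarrow> 'a) \<Rightarrow> bool" where
  "smooth_action M act \<longleftrightarrow> borel_action M act \<and> countably_separated (orbit_space M act)"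

definition fundamental_domain :: "'a measure \<Rightarrow> ('g \<Rightarrow> 'a \<Rightarrow> 'a) \<Rightarrow> 'a set \<Rightarrow> bool" where
  "fundamental_domain M act F \<longleftrightarrow>
     (\<exists>\<sigma> \<in> orbit_space M act \<rightarrow>\<^sub>M M.
        (\<forall>Q\<in>space (orbit_space M act). \<sigma> Q \<in> Q) \<and> F = \<sigma> ` space (orbit_space M act))"

definition free_action :: "'a measure \<Rightarrow> ('g::group_add \<Rightarrow> 'a \<Rightarrow> 'a) \<Rightarrow> bool" where
  "free_action M act \<longleftrightarrow> (\<forall>g. \<forall>x\<in>space M. act g x = x \<longrightarrow> g = 0)"

definition preserves_measure :: "'a measure \<Rightarrow> ('g \<Rightarrow> 'a \<Rightarrow> 'a) \<Rightarrow> bool" where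
  "preserves_measure M act \<longleftrightarrow> (\<forall>g. distr M M (act g) = M)"

definition measure_space_iso :: "'a measure \<Rightarrow> 'b measure \<Rightarrow> ('a \<Rightarrow> 'b) \<Rightarrow> bool" where
  "measure_space_iso M N f \<longleftrightarrow>
     bij_betw f (space M) (space N) \<and>
     f \<in> M \<rightarrow>\<^sub>M N \<and>
     inv_into (space M) f \<in> N \<rightarrow>\<^sub>M M \<and>
     distr M N f = N"

subsection \<open>Measure subgroup couplings\<close>

definition measure_subgroup_coupling ::
  "'h::topological_group_add measure \<Rightarrow> 'g::topological_group_add measure \<Rightarrow> 'a measure \<Rightarrow>
   ('h \<Rightarrow> 'a \<Rightarrow> 'a) \<Rightarrow> ('g \<Rightarrow> 'a \<Rightarrow> 'a) \<Rightarrow> 'a set \<Rightarrow> 'a set \<Rightarrow> 'a measure \<Rightarrow> 'a measure \<Rightarrow> bool" where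
  "measure_subgroup_coupling lamH lamG \<mu> actH actG FH FG \<nu>H \<nu>G \<longleftrightarrow>
     standard_borel \<mu> \<and> emeasure \<mu> (space \<mu>) \<noteq> 0 \<and>
     smooth_action \<mu> actH \<and> free_action \<mu> actH \<and> preserves_measure \<mu> actH \<and>
     smooth_action \<mu> actG \<and> free_action \<mu> actG \<and> preserves_measure \<mu> actG \<and>
     (\<forall>h g. \<forall>x\<in>space \<mu>. actH h (actG g x) = actG g (actH h x)) \<and>
     fundamental_domain \<mu> actH FH \<and> fundamental_domain \<mu> actG FG \<and>
     sets \<nu>H = sets (restrict_space \<mu> FH) \<and> sigma_finite_measure \<nu>H \<and>
     sets \<nu>G = sets (restrict_space \<mu> FG) \<and> finite_measure \<nu>G \<and>
     measure_space_iso (lamG \<Otimes>\<^sub>M \<nu>G) \<mu> (\<lambda>(g, x). actG g x) \<and>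
     measure_space_iso (lamH \<Otimes>\<^sub>M \<nu>H) \<mu> (\<lambda>(h, x). actH h x)"

definition induced_action ::
  "('h \<Rightarrow> 'a \<Rightarrow> 'a) \<Rightarrow> ('g \<Rightarrow> 'a \<Rightarrow> 'a) \<Rightarrow> 'a set \<Rightarrow> 'h \<Rightarrow> 'a \<Rightarrow> 'a" where
  "induced_action actH actG FG h x = (THE y. y \<in> FG \<and> y \<in> orbit actG (actH h x))"

definition cocycle ::
  "('h \<Rightarrow> 'a \<Rightarrow> 'a) \<Rightarrow> ('g \<Rightarrow> 'a \<Rightarrow> 'a) \<Rightarrow> 'a set \<Rightarrow> 'h \<Rightarrow> 'a \<Rightarrow> 'g" where
  "cocycle actH actG FG h x = (THE g. actH h x = actG g (induced_action actH actG FG h x))"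

definition Lp_coupling ::
  "real \<Rightarrow> 'h set \<Rightarrow> 'g::group_add set \<Rightarrow> ('h \<Rightarrow> 'a \<Rightarrow> 'a) \<Rightarrow> ('g \<Rightarrow> 'a \<Rightarrow> 'a) \<Rightarrow> 'a set \<Rightarrow>
   'a measure \<Rightarrow> bool" where
  "Lp_coupling p SH SG actH actG FG \<nu>G \<longleftrightarrow>
     (SUP h\<in>SH. Lp_norm p \<nu>G (\<lambda>x. real (word_length SG (cocycle actH actG FG h x)))) < \<infinity>"

definition coarsely_m_to_one ::
  "nat \<Rightarrow> real \<Rightarrow> 'h::group_add metric \<Rightarrow> 'g metric \<Rightarrow> ('h \<Rightarrow> 'a \<Rightarrow> 'a) \<Rightarrow> ('g \<Rightarrow> 'a \<Rightarrow> 'a) \<Rightarrow>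
   'a set \<Rightarrow> bool" where
  "coarsely_m_to_one m s dH dG actH actG FG \<longleftrightarrow>
     (\<forall>x\<in>FG. \<forall>g. \<exists>Z. finite Z \<and> card Z \<le> m \<and>
        {h. cocycle actH actG FG (- h) x \<in> mball_of dG g 3} \<subseteq> (\<Union>z\<in>Z. mball_of dH z s))"

end

theory Submission
  imports Defs
begin

text \<open>
  Let \<open>f\<close> be a function on \<open>G\<close> whose support has measure at most \<open>v\<close>. It lifts to the \<open>G\<close>-coordinate of
  the coupling space, \<open>g * x \<mapsto> f g\<close>, and the restrictions of the lift to the \<open>H\<close>-orbits are functions
  \<open>h \<mapsto> f (proj (h\<inverse> * y))\<close> on \<open>H\<close>. Integrated over \<open>y\<close>, the \<open>p\<close>-th powers of their norms give the norm of \<open>f\<close>, while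
  their gradients are controlled by the gradient of \<open>f\<close> because the lengths of the cocycle are bounded in \<open>L\<^sup>p\<close>;
  hence a single \<open>y\<close> does at least as well as \<open>f\<close> up to a constant. The coarse \<open>m\<close>-to-one condition bounds the
  support of every restriction by the number of balls of radius 3 needed to cover the support of \<open>f\<close>.
  That number is \<open>O(v)\<close> after \<open>f\<close> has been cut off outside the points around which its support has
  density at least one half; the part cut off is dominated by the gradient of \<open>f\<close>.
\<close>

section \<open>Powers and energies\<close>

text \<open>A set of measure \<open>v\<close> in a nondiscrete group can meet arbitrarily many balls
  that are far apart, while the coarse \<open>m\<close>-to-one condition counts balls only; this is
  why the thin part of the support must go before \<open>f\<close> is transferred. The loss is
  harmless only if the norm of \<open>f\<close> is large compared with its gradient. Otherwise the
  ratio is below a fixed constant, and it suffices that the profile of \<open>H\<close> has a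
  positive lower bound at large volumes. The support bound holds on every orbit, so \<open>y\<close>
  can be chosen for the ratio alone, by comparing two integrals. The choice must serve all
  generators of \<open>H\<close> at once, and bounds on the integral for each generator do not bound
  the integral of their supremum; the gradient is therefore first dominated by an average over a
  ball. Estimates concern \<open>p\<close>-th powers of norms, which add up under integration; roots
  are taken last. Right gradients fit because acting by \<open>H\<close> multiplies the
  \<open>G\<close>-coordinate on the right by a cocycle value. Unimodularity makes right
  translations and inversion preserve Haar measure.\<close>

lemma powr_sum_le:
  fixes a :: "'i \<Rightarrow> real"
  assumes "1 \<le> p" and "finite I" and "\<And>i. i \<in> I \<Longrightarrow> 0 \<le> a i"
  shows "(\<Sum>i\<in>I. a i) powr p \<le> real (card I) powr (p - 1) * (\<Sum>i\<in>I. a i powr p)"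
proof -
  \<comment> \<open>Jensen's inequality for \<open>x powr p\<close> with equal weights is applied to
    the positive terms, where the power is convex. Dropping zero terms changes neither sum and only
    lowers the number of terms.\<close>
  define J where "J = {i\<in>I. a i > 0}"
  have J: "finite J" "J \<subseteq> I" using assms by (auto simp: J_def)
  have z: "a i = 0" if "i \<in> I - J" for i using that assms(3)[of i] by (auto simp: J_def)
  have sJ: "(\<Sum>i\<in>I. a i) = (\<Sum>i\<in>J. a i)" "(\<Sum>i\<in>I. a i powr p) = (\<Sum>i\<in>J. a i powr p)"
    using z J assms(2) by (auto intro!: sum.mono_neutral_right)
  show ?thesis
  proof (cases "J = {}")
    case True
    then show ?thesis by (simp add: sJ)
  next
    case False
    define n where "n = real (card J)"
    have n: "n > 0" using False J by (simp add: n_def card_gt_0_iff)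
    have "(\<Sum>i\<in>J. (1/n) *\<^sub>R a i) powr p \<le> (\<Sum>i\<in>J. (1/n) * a i powr p)"
      by (rule convex_on_sum[OF J(1) False powr_convex[OF assms(1)]])
        (use n J False in \<open>simp_all add: n_def card_gt_0_iff\<close>, auto simp: J_def)
    then have "((\<Sum>i\<in>J. a i) / n) powr p \<le> (\<Sum>i\<in>J. a i powr p) / n"
      by (simp add: sum_divide_distrib)
    moreover have "((\<Sum>i\<in>J. a i) / n) powr p = (\<Sum>i\<in>J. a i) powr p / n powr p"
      by (rule powr_divide)
    moreover have "n powr p = n powr (p - 1) * n" using n by (simp add: powr_diff)
    ultimately have "(\<Sum>i\<in>J. a i) powr p \<le> n powr (p - 1) * (\<Sum>i\<in>J. a i powr p)"
      using n by (simp add: field_simps)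
    also have "\<dots> \<le> real (card I) powr (p - 1) * (\<Sum>i\<in>J. a i powr p)"
      using J assms n by (intro mult_right_mono powr_mono2 sum_nonneg) (auto simp: n_def card_mono)
    finally show ?thesis by (simp add: sJ)
  qed
qed

lemma powr_add_le:
  fixes a b :: real
  assumes "1 \<le> p"
  shows "\<bar>a + b\<bar> powr p \<le> 2 powr p * (\<bar>a\<bar> powr p + \<bar>b\<bar> powr p)"
proof -
  have "\<bar>a + b\<bar> powr p \<le> (\<bar>a\<bar> + \<bar>b\<bar>) powr p"
    using assms by (intro powr_mono2) auto
  also have "\<dots> = (\<Sum>i\<in>(UNIV::bool set). if i then \<bar>a\<bar> else \<bar>b\<bar>) powr p" by (simp add: UNIV_bool add.commute)
  also have "\<dots> \<le> 2 powr (p - 1) * (\<bar>a\<bar> powr p + \<bar>b\<bar> powr p)"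
    using powr_sum_le[OF assms, of UNIV "\<lambda>i. if i then \<bar>a\<bar> else \<bar>b\<bar>"]
    by (simp add: UNIV_bool add.commute)
  also have "\<dots> \<le> 2 powr p * (\<bar>a\<bar> powr p + \<bar>b\<bar> powr p)"
    by (intro mult_right_mono powr_mono) auto
  finally show ?thesis .
qed

text \<open>Has the same shape as the root taken in \<open>Lp_norm\<close>. For \<open>r > 0\<close>
  it is an order isomorphism of the extended half-line with inverse \<open>epowr (1 / r)\<close>, so
  norms can be compared through their \<open>p\<close>-th powers.\<close>

definition epowr :: "real \<Rightarrow> ennreal \<Rightarrow> ennreal" where
  "epowr r x = (if x = \<infinity> then \<infinity> else ennreal (enn2real x powr r))"

lemma epowr_top [simp]: "epowr r \<infinity> = \<infinity>" and epowr_top' [simp]: "epowr r top = top"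
  and epowr_0 [simp]: "epowr r 0 = 0"
  by (auto simp: epowr_def)

lemma epowr_ennreal: "x \<ge> 0 \<Longrightarrow> epowr r (ennreal x) = ennreal (x powr r)"
  by (simp add: epowr_def)

lemma epowr_mono: "0 < r \<Longrightarrow> x \<le> y \<Longrightarrow> epowr r x \<le> epowr r y"
  by (cases x; cases y) (auto simp: epowr_ennreal top_unique intro!: ennreal_leI powr_mono2)

lemma epowr_inverse: "0 < r \<Longrightarrow> epowr r (epowr (1 / r) x) = x"
  by (cases x) (auto simp: epowr_ennreal powr_powr)

lemma epowr_inverse': "0 < r \<Longrightarrow> epowr (1 / r) (epowr r x) = x"
  by (cases x) (auto simp: epowr_ennreal powr_powr)

lemma epowr_eq_0_iff [simp]: "epowr r x = 0 \<longleftrightarrow> x = 0"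
  by (cases x) (auto simp: epowr_ennreal)

lemma epowr_less_top [simp]: "epowr r x < top \<longleftrightarrow> x < top" "epowr r x = top \<longleftrightarrow> x = top"
  by (cases x; auto simp: epowr_ennreal)+

lemma epowr_mult:
  assumes "0 < c"
  shows "epowr r (ennreal c * x) = ennreal (c powr r) * epowr r x"
proof (cases x)
  case (real y)
  have "epowr r (ennreal c * x) = epowr r (ennreal (c * y))"
    using assms real by (simp add: ennreal_mult)
  also have "\<dots> = ennreal (c powr r * y powr r)"
    using real assms by (simp add: epowr_ennreal powr_mult)
  finally show ?thesis using real assms by (simp add: epowr_ennreal ennreal_mult)
next
  case top
  then show ?thesis using assms by (simp add: ennreal_mult_top)
qed

lemma epowr_divide:
  assumes "x \<noteq> 0" and "y \<noteq> \<infinity>"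
  shows "epowr r (x / y) = epowr r x / epowr r y"
proof (cases "y = 0")
  case True
  then show ?thesis using assms by (simp add: ennreal_divide_zero)
next
  case False
  then show ?thesis using assms
    by (cases x; cases y)
      (auto simp: epowr_ennreal divide_ennreal powr_divide ennreal_top_divide less_le)
qed

text \<open>An increasing bijection with increasing inverse commutes with suprema. This turns the
  supremum of norms in the gradient into the root of a supremum of integrals.\<close>

lemma epowr_SUP:
  assumes "0 < r"
  shows "(SUP i\<in>I. epowr r (f i)) = epowr r (SUP i\<in>I. f i)"
proof (rule antisym)
  show "(SUP i\<in>I. epowr r (f i)) \<le> epowr r (SUP i\<in>I. f i)"
    by (intro SUP_least epowr_mono assms SUP_upper)
  have "f i \<le> epowr (1 / r) (SUP i\<in>I. epowr r (f i))" if "i \<in> I" for i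
    using epowr_mono[OF _ SUP_upper[OF that, of "\<lambda>i. epowr r (f i)"], of "1 / r"] assms
    by (simp add: epowr_inverse')
  then have "(SUP i\<in>I. f i) \<le> epowr (1 / r) (SUP i\<in>I. epowr r (f i))"
    by (rule SUP_least)
  from epowr_mono[OF assms this] show "epowr r (SUP i\<in>I. f i) \<le> (SUP i\<in>I. epowr r (f i))"
    using assms by (simp add: epowr_inverse)
qed

text \<open>Integration yields inequalities between products, whereas profiles are built from
  ratios. A vanishing \<open>Q'\<close> makes the right side infinite; otherwise the product
  inequality forces \<open>Q > 0\<close>, so no infinite ratio can occur on the left.\<close>

lemma ennreal_ratio_le:
  fixes N N' Q Q' :: ennreal
  assumes "N \<noteq> 0" "N < \<infinity>" "N' \<noteq> 0" "N' < \<infinity>" "Q < \<infinity>" "K > 0"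
    and "Q' * N \<le> ennreal K * Q * N'"
  shows "N / Q \<le> ennreal K * (N' / Q')"
proof (cases "Q' = 0")
  case True
  then show ?thesis using assms by (simp add: ennreal_mult_top)
next
  case Q': False
  obtain n where n: "N = ennreal n" "n > 0" using assms(1,2) by (cases N) (auto simp: less_le)
  obtain n' where n': "N' = ennreal n'" "n' > 0" using assms(3,4) by (cases N') (auto simp: less_le)
  obtain q where q: "Q = ennreal q" "q \<ge> 0" using assms(5) by (cases Q) auto
  have "Q' * ennreal n < top"
    using le_less_trans[OF assms(7), of top] n(1) n'(1) q(1) by (simp add: ennreal_mult_less_top)
  then have "Q' \<noteq> top" using n by (auto simp: ennreal_top_mult)
  then obtain q' where q': "Q' = ennreal q'" "q' > 0" using Q' by (cases Q') (auto simp: less_le)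
  have le: "q' * n \<le> K * q * n'"
    using assms(7) n n' q q' assms(6) by (simp add: ennreal_mult'[symmetric])
  then have "q > 0" using q n n' q' by (cases "q = 0") (auto simp: mult_le_0_iff)
  then show ?thesis using n n' q' assms(6) le unfolding q
    by (simp add: divide_ennreal ennreal_mult'[symmetric] field_simps)
qed

text \<open>First moment argument: if \<open>\<Phi> y / N y\<close> exceeded \<open>b / a\<close> at
  every point with \<open>N y\<close> nonzero and finite, integrating would give
  \<open>b * a < b * a\<close>. Points with \<open>N y = 0\<close> cause no equality almost
  everywhere, since \<open>N\<close> has nonzero integral. The two conditions on \<open>N y\<close>
  are kept because the chosen point must provide a nonzero function of finite norm.\<close>

lemma ex_point_ratio_le:
  fixes \<Phi> N :: "'a \<Rightarrow> ennreal"
  assumes [measurable]: "\<Phi> \<in> borel_measurable M" "N \<in> borel_measurable M"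
    and N: "(\<integral>\<^sup>+ y. N y \<partial>M) = a" "a \<noteq> 0" "a < \<infinity>"
    and \<Phi>: "(\<integral>\<^sup>+ y. \<Phi> y \<partial>M) \<le> b" "b < \<infinity>"
  shows "\<exists>y\<in>space M. N y \<noteq> 0 \<and> N y < \<infinity> \<and> \<Phi> y * a \<le> b * N y"
proof (rule ccontr)
  assume "\<not> ?thesis"
  then have *: "b * N y < \<Phi> y * a" if "y \<in> space M" "N y \<noteq> 0" "N y < \<infinity>" for y
    using that by (auto simp: not_le)
  have fin: "AE y in M. N y < \<infinity>"
    using nn_integral_PInf_AE[of N M] N by (simp add: less_top)
  have "(\<integral>\<^sup>+ y. b * N y \<partial>M) < (\<integral>\<^sup>+ y. \<Phi> y * a \<partial>M)"
  proof (rule nn_integral_less)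
    show "(\<integral>\<^sup>+ y. b * N y \<partial>M) \<noteq> \<infinity>"
      using N \<Phi> by (auto simp: nn_integral_cmult ennreal_mult_eq_top_iff)
    show "AE y in M. b * N y \<le> \<Phi> y * a"
      using fin AE_space
    proof eventually_elim
      case (elim y)
      then show ?case using *[of y] by (cases "N y = 0") (auto intro: less_imp_le)
    qed
    show "\<not> (AE y in M. \<Phi> y * a \<le> b * N y)"
    proof
      assume "AE y in M. \<Phi> y * a \<le> b * N y"
      then have "AE y in M. N y = 0"
        using fin AE_space
      proof eventually_elim
        case (elim y)
        then show ?case using *[of y] by (cases "N y = 0") (auto dest: leD)
      qed
      then show False using N by (simp add: nn_integral_0_iff_AE[symmetric])
    qed
  qed simp_all
  also have "\<dots> \<le> b * a"
    using \<Phi> by (simp add: nn_integral_multc mult_right_mono)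
  finally show False using N by (simp add: nn_integral_cmult)
qed

section \<open>The \<open>p\<close>-th power of the norm and its quasi-triangle inequality\<close>

definition Lp_energy :: "real \<Rightarrow> 'a measure \<Rightarrow> ('a \<Rightarrow> real) \<Rightarrow> ennreal" where
  "Lp_energy p M f = (\<integral>\<^sup>+ x. ennreal (\<bar>f x\<bar> powr p) \<partial>M)"

lemma Lp_norm_eq: "Lp_norm p M f = epowr (1 / p) (Lp_energy p M f)"
  by (simp add: Lp_norm_def Lp_energy_def epowr_def Let_def)

lemma Lp_energy_eq_0_iff:
  assumes "f \<in> borel_measurable M"
  shows "Lp_energy p M f = 0 \<longleftrightarrow> (AE x in M. f x = 0)"
  unfolding Lp_energy_def using assms by (subst nn_integral_0_iff_AE) (auto simp: ennreal_eq_0_iff)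

lemma Lp_energy_cong_AE: "(AE x in M. f x = g x) \<Longrightarrow> Lp_energy p M f = Lp_energy p M g"
  unfolding Lp_energy_def by (rule nn_integral_cong_AE) auto

lemma Lp_energy_add_le:
  assumes "1 \<le> p" and [measurable]: "f \<in> borel_measurable M" "g \<in> borel_measurable M"
  shows "Lp_energy p M (\<lambda>x. f x + g x) \<le> ennreal (2 powr p) * (Lp_energy p M f + Lp_energy p M g)"
proof -
  have "Lp_energy p M (\<lambda>x. f x + g x) \<le>
      (\<integral>\<^sup>+ x. ennreal (2 powr p) * (ennreal (\<bar>f x\<bar> powr p) + ennreal (\<bar>g x\<bar> powr p)) \<partial>M)"
    unfolding Lp_energy_def
  proof (intro nn_integral_mono)
    fix x
    have "ennreal (\<bar>f x + g x\<bar> powr p) \<le> ennreal (2 powr p * (\<bar>f x\<bar> powr p + \<bar>g x\<bar> powr p))"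
      by (intro ennreal_leI powr_add_le assms)
    then show "ennreal (\<bar>f x + g x\<bar> powr p)
        \<le> ennreal (2 powr p) * (ennreal (\<bar>f x\<bar> powr p) + ennreal (\<bar>g x\<bar> powr p))"
      by (simp add: ennreal_mult)
  qed
  then show ?thesis by (simp add: Lp_energy_def nn_integral_cmult nn_integral_add)
qed

lemma Lp_energy_uminus [simp]: "Lp_energy p M (\<lambda>x. - f x) = Lp_energy p M f"
  by (simp add: Lp_energy_def)

lemma Lp_energy_diff_le:
  assumes "1 \<le> p" and [measurable]: "f \<in> borel_measurable M" "g \<in> borel_measurable M"
  shows "Lp_energy p M (\<lambda>x. f x - g x) \<le> ennreal (2 powr p) * (Lp_energy p M f + Lp_energy p M g)"
  using Lp_energy_add_le[OF assms(1,2), of "\<lambda>x. - g x"] by simp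

section \<open>Analysis on a unimodular group\<close>

lemma borel_measurable_uminus_group [measurable (raw)]:
  fixes f :: "'a \<Rightarrow> 'g::{topological_group_add, second_countable_topology}"
  assumes [measurable]: "f \<in> borel_measurable M"
  shows "(\<lambda>x. - f x) \<in> borel_measurable M"
proof -
  have "(uminus :: 'g \<Rightarrow> 'g) \<in> borel_measurable borel"
    by (intro borel_measurable_continuous_onI continuous_intros)
  then show ?thesis by measurable
qed

locale unimodular_group =
  fixes S :: "'g::{topological_group_add, t2_space, second_countable_topology} set"
    and d :: "'g metric" and lam :: "'g measure"
  assumes gen: "compact_symmetric_generating S"
    and adapted: "adapted_metric S d"
    and haar: "haar_measure lam"
    and unimod: "unimodular TYPE('g)"
begin

lemma sets_lam [measurable_cong, simp]: "sets lam = sets borel"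
  using haar by (simp add: haar_measure_def)

lemma space_lam [simp]: "space lam = UNIV"
  using sets_eq_imp_space_eq[OF sets_lam] by simp

lemma dist_left [simp]: "mdist d (g + x) (g + y) = mdist d x y"
  using adapted by (simp add: adapted_metric_def)

lemma mspace_d [simp]: "mspace d = UNIV"
  using adapted by (simp add: adapted_metric_def)

lemma dist_refl [simp]: "mdist d x x = 0"
  by simp

lemma dist_eq: "mdist d x y = mdist d 0 (- x + y)"
  using dist_left[of "- x" x y] by simp

lemma open_mball: "open (mball_of d x r)"
proof -
  have "openin (mtopology_of d) (mball_of d x r)"
    unfolding mball_of_def mtopology_of_def
    by (rule Metric_space.openin_mball[OF Metric_space_mspace_mdist])
  then show ?thesis using adapted by (simp add: adapted_metric_def)
qed

lemma compact_mcball: "compact (mcball_of d x r)"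
  using adapted by (simp add: adapted_metric_def)

lemma closed_mcball: "closed (mcball_of d x r)"
  by (intro compact_imp_closed compact_mcball)

lemma mball_measurable [measurable]: "mball_of d x r \<in> sets borel"
  by (intro borel_open open_mball)

lemma mcball_measurable [measurable]: "mcball_of d x r \<in> sets borel"
  by (intro borel_closed closed_mcball)

lemma emeasure_compact: "compact K \<Longrightarrow> emeasure lam K < \<infinity>"
  using haar by (simp add: haar_measure_def)

lemma emeasure_mcball: "emeasure lam (mcball_of d x r) < \<infinity>"
  by (intro emeasure_compact compact_mcball)

lemma emeasure_mball: "emeasure lam (mball_of d x r) < \<infinity>"
  by (rule le_less_trans[OF emeasure_mono emeasure_mcball[of x r]]) auto

lemma sigma_finite_lam: "sigma_finite_measure lam"
proof
  have "\<Union>(range (\<lambda>n::nat. mcball_of d 0 (real n))) = UNIV"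
    using real_arch_simple by fastforce
  then show "\<exists>A. countable A \<and> A \<subseteq> sets lam \<and> \<Union>A = space lam \<and> (\<forall>a\<in>A. emeasure lam a \<noteq> \<infinity>)"
    using emeasure_mcball by (intro exI[of _ "range (\<lambda>n::nat. mcball_of d 0 (real n))"])
      (auto simp: less_top)
qed

section \<open>Invariance of Haar integration\<close>

lemma nn_integral_left:
  assumes [measurable]: "f \<in> borel_measurable borel"
  shows "(\<integral>\<^sup>+ x. f (g + x) \<partial>lam) = (\<integral>\<^sup>+ x. f x \<partial>lam)"
proof -
  have "(\<integral>\<^sup>+ x. f x \<partial>lam) = (\<integral>\<^sup>+ x. f x \<partial>distr lam borel (\<lambda>x. g + x))"
    using haar by (simp add: haar_measure_def)
  also have "\<dots> = (\<integral>\<^sup>+ x. f (g + x) \<partial>lam)" by (intro nn_integral_distr) simp_all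
  finally show ?thesis by simp
qed

lemma distr_right: "distr lam borel (\<lambda>x. x + g) = lam"
  using haar unimod unfolding unimodular_def by blast

lemma nn_integral_right:
  assumes [measurable]: "f \<in> borel_measurable borel"
  shows "(\<integral>\<^sup>+ x. f (x + g) \<partial>lam) = (\<integral>\<^sup>+ x. f x \<partial>lam)"
proof -
  have "(\<integral>\<^sup>+ x. f x \<partial>lam) = (\<integral>\<^sup>+ x. f x \<partial>distr lam borel (\<lambda>x. x + g))"
    by (simp only: distr_right)
  also have "\<dots> = (\<integral>\<^sup>+ x. f (x + g) \<partial>lam)" by (intro nn_integral_distr) simp_all
  finally show ?thesis by simp
qed

lemma emeasure_left:
  assumes [measurable]: "A \<in> sets borel"
  shows "emeasure lam {x. g + x \<in> A} = emeasure lam A"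
  using nn_integral_left[of "indicator A" g] by (simp flip: nn_integral_indicator add: indicator_def)

text \<open>Translates of \<open>U\<close> by the points of a countable dense set cover the group,
  so a null \<open>U\<close> would make the whole group null.\<close>

lemma emeasure_open_pos:
  assumes "open U" "0 \<in> U"
  shows "emeasure lam U > 0"
proof (rule ccontr)
  assume "\<not> ?thesis"
  then have 0: "emeasure lam U = 0" by simp
  obtain D :: "'g set" where D: "countable D" "\<And>X. open X \<Longrightarrow> X \<noteq> {} \<Longrightarrow> \<exists>d\<in>D. d \<in> X"
    using countable_dense_exists by blast
  have cov: "\<exists>e\<in>D. - e + g \<in> U" for g
  proof -
    have "open ((\<lambda>e. - e + g) -` U)"
      by (intro open_vimage assms continuous_intros)
    moreover have "g \<in> (\<lambda>e. - e + g) -` U" using assms by simp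
    ultimately show ?thesis using D(2) by blast
  qed
  have U [measurable]: "U \<in> sets borel" using assms by simp
  have "(\<Union>e\<in>D. {x. - e + x \<in> U}) = UNIV" using cov by auto
  moreover have "(\<Union>e\<in>D. {x. - e + x \<in> U}) \<in> null_sets lam"
    using D(1) 0 by (intro null_sets_UN') (auto simp: null_sets_def emeasure_left)
  ultimately show False using haar by (simp add: haar_measure_def null_sets_def)
qed

lemma emeasure_mball_pos: "r > 0 \<Longrightarrow> emeasure lam (mball_of d 0 r) > 0"
  by (intro emeasure_open_pos open_mball) simp

text \<open>The integral over \<open>(x, y)\<close> of \<open>f (- y + x)\<close>, \<open>x\<close> in a ball, is computed in both orders.\<close>

lemma nn_integral_uminus:
  assumes [measurable]: "f \<in> borel_measurable borel"
  shows "(\<integral>\<^sup>+ x. f (- x) \<partial>lam) = (\<integral>\<^sup>+ x. f x \<partial>lam)"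
proof -
  interpret sigma_finite_measure lam by (rule sigma_finite_lam)
  interpret P: pair_sigma_finite lam lam ..
  define B where "B = mball_of d 0 1"
  define b where "b = emeasure lam B"
  have [measurable]: "B \<in> sets borel" by (simp add: B_def)
  have b: "b > 0" "b < \<infinity>"
    using emeasure_mball_pos[of 1] emeasure_mball[of 0 1] by (auto simp: B_def b_def)
  have 1: "(\<integral>\<^sup>+ y. indicator B x * f (- y + x) \<partial>lam) = indicator B x * (\<integral>\<^sup>+ y. f (- y) \<partial>lam)" for x
    using nn_integral_left[of "\<lambda>y. f (- y + x)" x] by (simp add: nn_integral_cmult minus_add)
  have 2: "(\<integral>\<^sup>+ x. indicator B x * f (- y + x) \<partial>lam) = (\<integral>\<^sup>+ x. indicator B (y + x) * f x \<partial>lam)" for y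
    using nn_integral_left[of "\<lambda>x. indicator B x * f (- y + x)" y] by (simp add: add.assoc[symmetric])
  \<comment> \<open>Unimodularity enters here: all right translates of \<open>B\<close> have the
    same mass \<open>b\<close>. Since \<open>0 < b < \<infinity>\<close>, this factor can be
    cancelled at the end.\<close>
  have 3: "(\<integral>\<^sup>+ y. indicator B (y + x) * f x \<partial>lam) = b * f x" for x
    using nn_integral_right[of "\<lambda>y. indicator B y" x] by (simp add: nn_integral_multc b_def)
  have "b * (\<integral>\<^sup>+ y. f (- y) \<partial>lam) = (\<integral>\<^sup>+ x. \<integral>\<^sup>+ y. indicator B x * f (- y + x) \<partial>lam \<partial>lam)"
    unfolding 1 by (simp add: nn_integral_multc b_def)
  also have "\<dots> = (\<integral>\<^sup>+ y. \<integral>\<^sup>+ x. indicator B x * f (- y + x) \<partial>lam \<partial>lam)"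
    by (intro P.Fubini'[symmetric]) measurable
  also have "\<dots> = (\<integral>\<^sup>+ x. \<integral>\<^sup>+ y. indicator B (y + x) * f x \<partial>lam \<partial>lam)"
    unfolding 2 by (intro P.Fubini'[symmetric]) measurable
  also have "\<dots> = b * (\<integral>\<^sup>+ x. f x \<partial>lam)"
    unfolding 3 by (simp add: nn_integral_cmult)
  finally show ?thesis using b by (auto simp: ennreal_mult_cancel_left)
qed

lemma Lp_energy_right:
  assumes [measurable]: "f \<in> borel_measurable borel"
  shows "Lp_energy p lam (\<lambda>x. f (x + g)) = Lp_energy p lam f"
  unfolding Lp_energy_def by (rule nn_integral_right[of "\<lambda>x. ennreal (\<bar>f x\<bar> powr p)"]) simp

section \<open>Word length and translation estimates\<close>

lemma word_length_word: "\<exists>w. length w = word_length S g \<and> set w \<subseteq> S \<and> sum_list w = g"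
proof -
  have "\<exists>n w. length w = n \<and> set w \<subseteq> S \<and> sum_list w = g"
    using gen by (auto simp: compact_symmetric_generating_def)
  then show ?thesis unfolding word_length_def by (rule LeastI_ex)
qed

lemma word_length_le: "\<exists>L\<ge>0. \<exists>C\<ge>0. \<forall>x. real (word_length S x) \<le> L * mdist d 0 x + C"
proof -
  obtain L C where "L \<ge> 1" "C \<ge> 0" and *: "\<And>x y. real (word_length S (- x + y)) \<le> L * mdist d x y + C"
    using adapted unfolding adapted_metric_def by blast
  then show ?thesis using *[of 0] by (intro exI[of _ L] exI[of _ C] conjI) auto
qed

lemma word_length_bounded: "\<exists>n. \<forall>x. mdist d 0 x \<le> r \<longrightarrow> word_length S x \<le> n"
proof -
  obtain L C where LC: "L \<ge> 0" "C \<ge> 0" "\<And>x. real (word_length S x) \<le> L * mdist d 0 x + C"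
    using word_length_le by blast
  have "word_length S x \<le> nat \<lceil>L * r + C\<rceil>" if "mdist d 0 x \<le> r" for x
  proof -
    have "real (word_length S x) \<le> L * r + C"
      using LC(3)[of x] mult_left_mono[OF that LC(1)] by linarith
    then show ?thesis by linarith
  qed
  then show ?thesis by blast
qed

lemma generators_bounded: "\<exists>r. \<forall>t\<in>S. mdist d 0 t \<le> r"
proof -
  obtain L C where "L \<ge> 1" "C \<ge> 0" and *: "\<And>x y. mdist d x y / L - C \<le> real (word_length S (- x + y))"
    using adapted unfolding adapted_metric_def by blast
  have "mdist d 0 t \<le> L * (1 + C)" if "t \<in> S" for t
  proof -
    have "word_length S t \<le> 1" unfolding word_length_def
      by (rule Least_le) (use that in \<open>auto intro!: exI[of _ "[t]"]\<close>)
    then have "mdist d 0 t / L \<le> 1 + C" using *[of 0 t] by simp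
    then show ?thesis using \<open>L \<ge> 1\<close> by (simp add: field_simps)
  qed
  then show ?thesis by blast
qed

lemma uminus_gen: "t \<in> S \<Longrightarrow> - t \<in> S"
  using gen by (auto simp: compact_symmetric_generating_def)

text \<open>The products of exactly \<open>k\<close> generators form a compact set, a continuous
  image of a power of \<open>S\<close>. The length is the first index at which an element enters
  this sequence of Borel sets.\<close>

lemma word_length_measurable [measurable]: "word_length S \<in> borel \<rightarrow>\<^sub>M count_space UNIV"
proof -
  define V where "V k = {sum_list w | w. length w = k \<and> set w \<subseteq> S}" for k
  have "V (Suc k) = (\<lambda>(x, y). x + y) ` (S \<times> V k)" for k
  proof (intro equalityI subsetI)
    fix g assume "g \<in> V (Suc k)"
    then show "g \<in> (\<lambda>(x, y). x + y) ` (S \<times> V k)"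
      by (fastforce simp: V_def length_Suc_conv)
  next
    fix g assume "g \<in> (\<lambda>(x, y). x + y) ` (S \<times> V k)"
    then obtain x w where "g = x + sum_list w" "x \<in> S" "length w = k" "set w \<subseteq> S"
      by (auto simp: V_def)
    then show "g \<in> V (Suc k)" by (auto simp: V_def intro!: exI[of _ "x # w"])
  qed
  moreover have "V 0 = {0}" by (auto simp: V_def)
  moreover have "compact S" using gen by (simp add: compact_symmetric_generating_def)
  ultimately have "compact (V k)" for k
    by (induction k) (auto intro!: compact_continuous_image compact_Times continuous_intros
        simp: case_prod_beta)
  then have [measurable]: "V k \<in> sets borel" for k by (intro borel_compact)
  have "word_length S = (\<lambda>g. LEAST n. g \<in> V n)"
    by (auto simp: word_length_def V_def fun_eq_iff intro!: arg_cong[where f = Least])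
  then show ?thesis by simp
qed

text \<open>The difference telescopes along the prefixes of \<open>w\<close>, and right invariance
  reduces each summand to the translate by one letter; the power of the length is the price of
  convexity. The sum over letters is kept instead of a supremum because it will be integrated over a
  parameter on which \<open>f\<close> depends.\<close>

lemma Lp_energy_word_le:
  assumes p: "1 \<le> p" and [measurable]: "f \<in> borel_measurable borel"
  shows "Lp_energy p lam (\<lambda>x. f x - f (x + sum_list w))
    \<le> ennreal (real (length w) powr (p - 1)) * (\<Sum>t\<leftarrow>w. Lp_energy p lam (\<lambda>x. f x - f (x + t)))"
proof -
  let ?n = "length w"
  define a where "a i x = f (x + sum_list (take i w)) - f (x + sum_list (take (Suc i) w))" for i x
  have [measurable]: "a i \<in> borel_measurable borel" for i unfolding a_def by measurable
  have tel: "f x - f (x + sum_list w) = (\<Sum>i<?n. a i x)" for x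
    unfolding a_def by (subst sum_lessThan_telescope') simp
  have E: "Lp_energy p lam (a i) = Lp_energy p lam (\<lambda>x. f x - f (x + w ! i))" if "i < ?n" for i
  proof -
    have "a i = (\<lambda>x. f (x + sum_list (take i w)) - f (x + sum_list (take i w) + w ! i))"
      using that by (simp add: a_def fun_eq_iff take_Suc_conv_app_nth add.assoc)
    then show ?thesis
      using Lp_energy_right[of "\<lambda>x. f x - f (x + w ! i)" p "sum_list (take i w)"] by simp
  qed
  have "Lp_energy p lam (\<lambda>x. f x - f (x + sum_list w))
      \<le> (\<integral>\<^sup>+ x. ennreal (real ?n powr (p - 1)) * (\<Sum>i<?n. ennreal (\<bar>a i x\<bar> powr p)) \<partial>lam)"
    unfolding Lp_energy_def tel
  proof (intro nn_integral_mono)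
    fix x
    have "\<bar>\<Sum>i<?n. a i x\<bar> powr p \<le> (\<Sum>i<?n. \<bar>a i x\<bar>) powr p"
      using p by (intro powr_mono2 sum_abs) auto
    also have "\<dots> \<le> real ?n powr (p - 1) * (\<Sum>i<?n. \<bar>a i x\<bar> powr p)"
      using powr_sum_le[OF p, of "{..<?n}" "\<lambda>i. \<bar>a i x\<bar>"] by simp
    finally have "ennreal (\<bar>\<Sum>i<?n. a i x\<bar> powr p)
        \<le> ennreal (real ?n powr (p - 1) * (\<Sum>i<?n. \<bar>a i x\<bar> powr p))" by (rule ennreal_leI)
    also have "\<dots> = ennreal (real ?n powr (p - 1)) * (\<Sum>i<?n. ennreal (\<bar>a i x\<bar> powr p))"
      by (simp add: ennreal_mult sum_nonneg)
    finally show "ennreal (\<bar>\<Sum>i<?n. a i x\<bar> powr p)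
        \<le> ennreal (real ?n powr (p - 1)) * (\<Sum>i<?n. ennreal (\<bar>a i x\<bar> powr p))" .
  qed
  also have "\<dots> = ennreal (real ?n powr (p - 1)) * (\<Sum>i<?n. Lp_energy p lam (a i))"
    by (simp add: nn_integral_cmult nn_integral_sum Lp_energy_def del: sum_ennreal)
  also have "(\<Sum>i<?n. Lp_energy p lam (a i)) = (\<Sum>t\<leftarrow>w. Lp_energy p lam (\<lambda>x. f x - f (x + t)))"
    by (simp add: sum_list_sum_nth atLeast0LessThan E)
  finally show ?thesis .
qed

definition energy :: "real \<Rightarrow> ('g \<Rightarrow> real) \<Rightarrow> ennreal" where
  "energy p f = (SUP t\<in>S. Lp_energy p lam (\<lambda>x. f x - f (x + t)))"

lemma energy_upper: "t \<in> S \<Longrightarrow> Lp_energy p lam (\<lambda>x. f x - f (x + t)) \<le> energy p f"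
  unfolding energy_def by (rule SUP_upper)

text \<open>The convexity factor with exponent \<open>p - 1\<close> and the number of letters
  combine to the \<open>p\<close>-th power of the length. This exponent is what makes
  \<open>L^p\<close> integrability of the cocycle the matching hypothesis.\<close>

lemma Lp_energy_translate_le:
  assumes p: "1 \<le> p" and f [measurable]: "f \<in> borel_measurable borel"
  shows "Lp_energy p lam (\<lambda>x. f x - f (x + g)) \<le> ennreal (real (word_length S g) powr p) * energy p f"
proof -
  obtain w where w: "length w = word_length S g" "set w \<subseteq> S" "sum_list w = g"
    using word_length_word by blast
  define n where "n = length w"
  have "(\<Sum>t\<leftarrow>w. Lp_energy p lam (\<lambda>x. f x - f (x + t))) \<le> (\<Sum>t\<leftarrow>w. energy p f)"
    using w(2) by (intro sum_list_mono energy_upper) auto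
  also have "\<dots> = ennreal (real n) * energy p f"
    by (simp add: sum_list_triv n_def ennreal_of_nat_eq_real_of_nat)
  finally have "Lp_energy p lam (\<lambda>x. f x - f (x + g))
      \<le> ennreal (real n powr (p - 1)) * (ennreal (real n) * energy p f)"
    using order_trans[OF Lp_energy_word_le[OF p f, of w] mult_left_mono] w(3)
    by (simp add: n_def)
  also have "\<dots> = ennreal (real n powr (p - 1) * real n) * energy p f"
    by (simp add: ennreal_mult mult.assoc)
  also have "real n powr (p - 1) * real n = real n powr p"
    by (cases "n = 0") (simp_all add: powr_diff)
  finally show ?thesis using w(1) by (simp add: n_def)
qed

lemma energy_le:
  assumes p: "1 \<le> p" and [measurable]: "f \<in> borel_measurable borel"
  shows "energy p f \<le> ennreal (2 powr p * 2) * Lp_energy p lam f"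
  unfolding energy_def
proof (rule SUP_least)
  fix t
  have "Lp_energy p lam (\<lambda>x. f x - f (x + t))
      \<le> ennreal (2 powr p) * (Lp_energy p lam f + Lp_energy p lam (\<lambda>x. f (x + t)))"
    by (intro Lp_energy_diff_le p) measurable
  also have "\<dots> = ennreal (2 powr p * 2) * Lp_energy p lam f"
    by (simp add: Lp_energy_right ennreal_mult mult.assoc mult_2)
  finally show "Lp_energy p lam (\<lambda>x. f x - f (x + t)) \<le> ennreal (2 powr p * 2) * Lp_energy p lam f" .
qed

section \<open>The profile in terms of \<open>p\<close>-th powers\<close>

lemma right_gradient_norm_eq: "0 < p \<Longrightarrow> right_gradient_norm p S lam f = epowr (1 / p) (energy p f)"
  by (simp add: right_gradient_norm_def energy_def Lp_norm_eq epowr_SUP)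

lemma Lp_space_iff: "0 < p \<Longrightarrow> f \<in> Lp_space p lam \<longleftrightarrow> f \<in> borel_measurable borel \<and> Lp_energy p lam f < \<infinity>"
  by (simp add: Lp_space_def Lp_norm_eq measurable_cong_sets[OF sets_lam refl])

text \<open>Extended division of a nonzero value by zero is already \<open>\<infinity>\<close>, so
  the case distinction for a vanishing gradient is absorbed by the quotient.\<close>

lemma isop_ratio_eq:
  assumes p: "1 \<le> p" and f: "f \<in> Lp_space p lam" "\<not> (AE x in lam. f x = 0)"
  shows "(if right_gradient_norm p S lam f = 0 then \<infinity> else Lp_norm p lam f / right_gradient_norm p S lam f)
    = epowr (1 / p) (Lp_energy p lam f / energy p f)"
proof -
  have f' [measurable]: "f \<in> borel_measurable borel" and fin: "Lp_energy p lam f < \<infinity>"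
    using f p by (auto simp: Lp_space_iff)
  have nz: "Lp_energy p lam f \<noteq> 0"
    using f(2) by (simp add: Lp_energy_eq_0_iff)
  have "energy p f < \<infinity>"
    using energy_le[OF p f'] fin by (auto intro: le_less_trans simp: ennreal_mult_less_top)
  then show ?thesis using p nz
    by (auto simp: right_gradient_norm_eq Lp_norm_eq epowr_divide ennreal_divide_zero)
qed

lemma isop_profile_ge:
  assumes p: "1 \<le> p" and f: "f \<in> borel_measurable borel" "Lp_energy p lam f < \<infinity>" "Lp_energy p lam f \<noteq> 0"
    and A: "A \<in> sets borel" "emeasure lam A \<le> ennreal v" "\<And>x. x \<notin> A \<Longrightarrow> f x = 0"
  shows "epowr (1 / p) (Lp_energy p lam f / energy p f) \<le> isop_profile p S lam v"
proof -
  have L: "f \<in> Lp_space p lam" "\<not> (AE x in lam. f x = 0)"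
    using f p Lp_energy_eq_0_iff[of f lam p] by (auto simp: Lp_space_iff)
  have "epowr (1 / p) (Lp_energy p lam f / energy p f) \<le> isop_J p S lam A"
    unfolding isop_J_def using L A(3) by (subst isop_ratio_eq[OF p L, symmetric]) (intro SUP_upper, auto)
  also have "\<dots> \<le> isop_profile p S lam v"
    unfolding isop_profile_def by (intro SUP_upper) (use A in auto)
  finally show ?thesis .
qed

text \<open>The definition admits functions that vanish outside \<open>A\<close> only almost
  everywhere, but supports will be covered pointwise. Setting \<open>f\<close> to zero off
  \<open>A\<close> changes neither its norm nor its gradient, because right translations preserve
  null sets.\<close>

lemma isop_profile_le:
  assumes p: "1 \<le> p"
    and *: "\<And>f A. f \<in> borel_measurable borel \<Longrightarrow> Lp_energy p lam f < \<infinity> \<Longrightarrow> Lp_energy p lam f \<noteq> 0 \<Longrightarrow>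
      A \<in> sets borel \<Longrightarrow> emeasure lam A \<le> ennreal v \<Longrightarrow> (\<And>x. x \<notin> A \<Longrightarrow> f x = 0) \<Longrightarrow>
      epowr (1 / p) (Lp_energy p lam f / energy p f) \<le> c"
  shows "isop_profile p S lam v \<le> c"
  unfolding isop_profile_def isop_J_def
proof (intro SUP_least)
  fix A f
  assume A': "A \<in> {A \<in> sets lam. emeasure lam A \<le> ennreal v}"
    and f': "f \<in> {f \<in> Lp_space p lam. \<not> (AE x in lam. f x = 0) \<and> (AE x in lam. x \<notin> A \<longrightarrow> f x = 0)}"
  then have A [measurable]: "A \<in> sets borel" and Av: "emeasure lam A \<le> ennreal v"
    and f [measurable]: "f \<in> borel_measurable borel" and fin: "Lp_energy p lam f < \<infinity>"
    and L: "f \<in> Lp_space p lam" "\<not> (AE x in lam. f x = 0)" and fA: "AE x in lam. x \<notin> A \<longrightarrow> f x = 0"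
    using p by (auto simp: Lp_space_iff)
  have nz: "Lp_energy p lam f \<noteq> 0"
    using L(2) by (simp add: Lp_energy_eq_0_iff)
  define f1 where "f1 x = (if x \<in> A then f x else 0)" for x
  have [measurable]: "f1 \<in> borel_measurable borel" unfolding f1_def by measurable
  have eq: "AE x in lam. f x = f1 x" using fA by (auto simp: f1_def)
  have eq': "AE x in lam. f (x + t) = f1 (x + t)" for t
  proof -
    have "AE x in distr lam borel (\<lambda>x. x + t). f x = f1 x"
      using eq by (simp only: distr_right)
    then show ?thesis by (subst (asm) AE_distr_iff) auto
  qed
  have E: "Lp_energy p lam f1 = Lp_energy p lam f" using eq by (intro Lp_energy_cong_AE) auto
  have "Lp_energy p lam (\<lambda>x. f1 x - f1 (x + t)) = Lp_energy p lam (\<lambda>x. f x - f (x + t))" for t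
    using eq eq'[of t] by (intro Lp_energy_cong_AE) auto
  then have E': "energy p f1 = energy p f" by (simp add: energy_def)
  show "(if right_gradient_norm p S lam f = 0 then \<infinity> else Lp_norm p lam f / right_gradient_norm p S lam f) \<le> c"
    unfolding isop_ratio_eq[OF p L] E[symmetric] E'[symmetric]
    by (rule *[of _ A]) (use fin nz Av E in \<open>auto simp: f1_def\<close>)
qed

section \<open>Removing the thin part of the support\<close>

text \<open>A function whose norm is large compared with its gradient is concentrated on the points around
  which its support has density at least one half, and these points are covered by few balls.\<close>

lemma Lp_energy_low_density_le:
  assumes p: "1 \<le> p" and f [measurable]: "f \<in> borel_measurable borel" and A [measurable]: "A \<in> sets borel"
    and fA: "\<And>x. x \<notin> A \<Longrightarrow> f x = 0"
    and n: "\<And>x. mdist d 0 x < 1 \<Longrightarrow> word_length S x \<le> n"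
    and D_sets [measurable]: "D \<in> sets borel" and D: "\<And>g. g \<notin> D \<Longrightarrow>
      2 * (\<integral>\<^sup>+ x. indicator (mball_of d 0 1) x * indicator A (g + x) \<partial>lam) < emeasure lam (mball_of d 0 1)"
  shows "Lp_energy p lam (\<lambda>g. if g \<in> D then 0 else f g) \<le> ennreal (2 * real n powr p) * energy p f"
proof -
  interpret sigma_finite_measure lam by (rule sigma_finite_lam)
  interpret P: pair_sigma_finite lam lam ..
  define B where "B = mball_of d 0 1"
  have [measurable]: "B \<in> sets borel" by (simp add: B_def)
  define e where "e g = (if g \<in> D then 0 else f g)" for g
  have [measurable]: "e \<in> borel_measurable borel" unfolding e_def by measurable
  define \<beta> where "\<beta> = emeasure lam B"
  have \<beta>: "\<beta> \<noteq> 0" "\<beta> \<noteq> top" using emeasure_mball_pos[of 1] emeasure_mball[of 0 1] by (auto simp: \<beta>_def B_def)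
  \<comment> \<open>For \<open>g\<close> outside \<open>D\<close>, at least half of the points
    \<open>g + x\<close> with \<open>x\<close> in \<open>B\<close> lie outside \<open>A\<close>.
    There \<open>f\<close> vanishes, so the difference equals \<open>f g\<close> and half of the
    mass of \<open>B\<close> already recovers the left side.\<close>
  have pt: "\<beta> * ennreal (\<bar>e g\<bar> powr p)
      \<le> 2 * (\<integral>\<^sup>+ x. indicator B x * ennreal (\<bar>f g - f (g + x)\<bar> powr p) \<partial>lam)" for g
  proof (cases "e g = 0")
    case False
    then have "g \<notin> D" by (auto simp: e_def)
    define m where "m = (\<integral>\<^sup>+ x. indicator B x * indicator A (g + x) \<partial>lam)"
    define m' where "m' = (\<integral>\<^sup>+ x. indicator B x * indicator (- A) (g + x) \<partial>lam)"
    have "\<beta> = (\<integral>\<^sup>+ x. indicator B x \<partial>lam)" by (simp add: \<beta>_def)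
    also have "\<dots> = (\<integral>\<^sup>+ x. indicator B x * indicator A (g + x) + indicator B x * indicator (- A) (g + x) \<partial>lam)"
      by (intro nn_integral_cong) (auto split: split_indicator)
    also have "\<dots> = m + m'" unfolding m_def m'_def by (intro nn_integral_add) measurable
    finally have \<beta>m: "\<beta> = m + m'" .
    have "2 * m < m + m'" using D[OF \<open>g \<notin> D\<close>] \<beta>m by (simp add: m_def \<beta>_def B_def)
    then have "m \<le> m'" using add_left_mono[of m' m m] by (auto simp: mult_2 not_less intro: ccontr)
    then have "\<beta> \<le> 2 * m'" using \<beta>m by (simp add: mult_2 add_right_mono)
    then have "\<beta> * ennreal (\<bar>e g\<bar> powr p) \<le> 2 * (m' * ennreal (\<bar>e g\<bar> powr p))"
      by (simp add: mult.assoc[symmetric] mult_right_mono)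
    also have "m' * ennreal (\<bar>e g\<bar> powr p)
        = (\<integral>\<^sup>+ x. indicator B x * indicator (- A) (g + x) * ennreal (\<bar>e g\<bar> powr p) \<partial>lam)"
      unfolding m'_def by (intro nn_integral_multc[symmetric]) measurable
    also have "\<dots> \<le> (\<integral>\<^sup>+ x. indicator B x * ennreal (\<bar>f g - f (g + x)\<bar> powr p) \<partial>lam)"
      using fA \<open>g \<notin> D\<close> by (intro nn_integral_mono) (auto simp: e_def split: split_indicator)
    finally show ?thesis by (simp add: mult_left_mono)
  qed simp
  have "\<beta> * Lp_energy p lam e = (\<integral>\<^sup>+ g. \<beta> * ennreal (\<bar>e g\<bar> powr p) \<partial>lam)"
    by (simp add: nn_integral_cmult Lp_energy_def)
  also have "\<dots> \<le> (\<integral>\<^sup>+ g. 2 * (\<integral>\<^sup>+ x. indicator B x * ennreal (\<bar>f g - f (g + x)\<bar> powr p) \<partial>lam) \<partial>lam)"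
    by (intro nn_integral_mono pt)
  also have "\<dots> = 2 * (\<integral>\<^sup>+ g. \<integral>\<^sup>+ x. indicator B x * ennreal (\<bar>f g - f (g + x)\<bar> powr p) \<partial>lam \<partial>lam)"
    by (simp add: nn_integral_cmult)
  finally have 1: "\<beta> * Lp_energy p lam e
    \<le> 2 * (\<integral>\<^sup>+ g. \<integral>\<^sup>+ x. indicator B x * ennreal (\<bar>f g - f (g + x)\<bar> powr p) \<partial>lam \<partial>lam)" .
  have "(\<integral>\<^sup>+ g. \<integral>\<^sup>+ x. indicator B x * ennreal (\<bar>f g - f (g + x)\<bar> powr p) \<partial>lam \<partial>lam)
      = (\<integral>\<^sup>+ x. \<integral>\<^sup>+ g. indicator B x * ennreal (\<bar>f g - f (g + x)\<bar> powr p) \<partial>lam \<partial>lam)"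
    by (intro P.Fubini'[symmetric]) measurable
  also have "\<dots> = (\<integral>\<^sup>+ x. indicator B x * Lp_energy p lam (\<lambda>g. f g - f (g + x)) \<partial>lam)"
    by (simp add: nn_integral_cmult Lp_energy_def)
  also have "\<dots> \<le> (\<integral>\<^sup>+ x. (ennreal (real n powr p) * energy p f) * indicator B x \<partial>lam)"
  proof (intro nn_integral_mono)
    fix x
    have "Lp_energy p lam (\<lambda>g. f g - f (g + x)) \<le> ennreal (real n powr p) * energy p f" if "x \<in> B"
      using that n[of x] p
      by (intro order_trans[OF Lp_energy_translate_le[OF p f]] mult_right_mono ennreal_leI powr_mono2)
        (auto simp: B_def)
    then show "indicator B x * Lp_energy p lam (\<lambda>g. f g - f (g + x)) \<le> (ennreal (real n powr p) * energy p f) * indicator B x"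
      by (auto split: split_indicator)
  qed
  also have "\<dots> = \<beta> * (ennreal (real n powr p) * energy p f)"
    by (subst nn_integral_cmult_indicator) (simp_all add: \<beta>_def mult.commute)
  finally have "\<beta> * Lp_energy p lam e \<le> 2 * (\<beta> * (ennreal (real n powr p) * energy p f))"
    by (rule order_trans[OF 1 mult_left_mono]) simp
  then have "\<beta> * Lp_energy p lam e \<le> \<beta> * (ennreal (2 * real n powr p) * energy p f)"
    by (simp add: ennreal_mult mult_ac)
  then show ?thesis using \<beta> by (simp add: ennreal_mult_le_mult_iff e_def[abs_def])
qed

text \<open>Take a 2-separated subset of \<open>D\<close> of largest size. The unit balls around its
  points are disjoint and each shares with \<open>A\<close> at least half the mass of a unit ball,
  which bounds the size and shows that a largest subset exists. By maximality every point of
  \<open>D\<close> is closer than 2 to this subset, well within the radius 3 of the coarse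
  \<open>m\<close>-to-one condition.\<close>

lemma high_density_covering:
  assumes A [measurable]: "A \<in> sets borel" and v: "emeasure lam A \<le> ennreal v" "0 \<le> v"
    and D: "\<And>g. g \<in> D \<Longrightarrow>
      emeasure lam (mball_of d 0 1) \<le> 2 * (\<integral>\<^sup>+ x. indicator (mball_of d 0 1) x * indicator A (g + x) \<partial>lam)"
  shows "\<exists>Z. finite Z \<and> real (card Z) \<le> 2 * v / measure lam (mball_of d 0 1) \<and> (\<forall>x\<in>D. \<exists>z\<in>Z. mdist d z x < 3)"
proof -
  define \<beta> where "\<beta> = measure lam (mball_of d 0 1)"
  have \<beta>: "emeasure lam (mball_of d 0 1) = ennreal \<beta>"
    using emeasure_mball[of 0 1] unfolding \<beta>_def by (intro emeasure_eq_ennreal_measure) auto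
  have \<beta>0: "\<beta> > 0" using emeasure_mball_pos[of 1] by (simp add: \<beta>)
  define P where "P Z \<longleftrightarrow> finite Z \<and> Z \<subseteq> D \<and> (\<forall>z\<in>Z. \<forall>z'\<in>Z. z \<noteq> z' \<longrightarrow> mdist d z z' \<ge> 2)" for Z
  have bound: "real (card Z) \<le> 2 * v / \<beta>" if "P Z" for Z
  proof -
    have Z: "finite Z" "Z \<subseteq> D" and sep: "\<And>z z'. z \<in> Z \<Longrightarrow> z' \<in> Z \<Longrightarrow> z \<noteq> z' \<Longrightarrow> mdist d z z' \<ge> 2"
      using that by (auto simp: P_def)
    have "ennreal \<beta> \<le> 2 * (\<integral>\<^sup>+ x. indicator (mball_of d z 1) x * indicator A x \<partial>lam)" if "z \<in> Z" for z
    proof -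
      have "(\<integral>\<^sup>+ x. indicator (mball_of d 0 1) x * indicator A (z + x) \<partial>lam)
          = (\<integral>\<^sup>+ x. indicator (mball_of d 0 1) (- z + (z + x)) * indicator A (z + x) \<partial>lam)" by simp
      also have "\<dots> = (\<integral>\<^sup>+ x. indicator (mball_of d 0 1) (- z + x) * indicator A x \<partial>lam)"
        by (rule nn_integral_left[of "\<lambda>x. indicator (mball_of d 0 1) (- z + x) * indicator A x"]) measurable
      also have "\<dots> = (\<integral>\<^sup>+ x. indicator (mball_of d z 1) x * indicator A x \<partial>lam)"
        by (intro nn_integral_cong arg_cong2[where f = times]) (auto simp: dist_eq[of z] split: split_indicator)
      finally show ?thesis using D[of z] that Z \<beta> by auto
    qed
    then have "(\<Sum>z\<in>Z. ennreal \<beta>) \<le> (\<Sum>z\<in>Z. 2 * (\<integral>\<^sup>+ x. indicator (mball_of d z 1) x * indicator A x \<partial>lam))"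
      by (rule sum_mono)
    also have "\<dots> = 2 * (\<integral>\<^sup>+ x. (\<Sum>z\<in>Z. indicator (mball_of d z 1) x * indicator A x) \<partial>lam)"
      by (simp add: nn_integral_sum sum_distrib_left)
    also have "\<dots> \<le> 2 * (\<integral>\<^sup>+ x. indicator A x \<partial>lam)"
    proof (intro mult_left_mono nn_integral_mono)
      fix x
      define h where "h z = (indicator (mball_of d z 1) x * indicator A x :: ennreal)" for z
      have "sum h Z \<le> 1"
      proof (cases "\<exists>z\<in>Z. mdist d z x < 1")
        case True
        then obtain z where z: "z \<in> Z" "mdist d z x < 1" by blast
        have "\<not> mdist d z' x < 1" if "z' \<in> Z" "z' \<noteq> z" for z'
          using sep[OF that(1) z(1) that(2)] mdist_triangle[of z' d x z] z(2) by (auto simp: mdist_commute[of d z x])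
        then have "sum h Z = sum h {z}"
          using z Z by (intro sum.mono_neutral_right) (auto simp: h_def)
        also have "\<dots> = h z" by simp
        also have "\<dots> \<le> 1" by (auto simp: h_def indicator_def)
        finally show ?thesis .
      next
        case False
        then have "sum h Z = 0" by (intro sum.neutral) (auto simp: h_def)
        then show ?thesis by simp
      qed
      then show "(\<Sum>z\<in>Z. indicator (mball_of d z 1) x * indicator A x) \<le> (indicator A x :: ennreal)"
        unfolding h_def[symmetric] by (cases "x \<in> A") (simp, simp add: h_def)
    qed simp
    also have "\<dots> \<le> 2 * ennreal v" using v by (simp add: mult_left_mono)
    finally have "ennreal (real (card Z) * \<beta>) \<le> ennreal (2 * v)"
      using \<beta>0 v(2) by (simp add: ennreal_mult ennreal_of_nat_eq_real_of_nat)
    then show ?thesis using \<beta>0 v(2) by (simp add: field_simps)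
  qed
  have "P {}" by (simp add: P_def)
  have "card Z \<le> nat \<lfloor>2 * v / \<beta>\<rfloor>" if "P Z" for Z
    by (rule le_nat_floor) (rule bound[OF that])
  then have "\<forall>Z. P Z \<longrightarrow> card Z < Suc (nat \<lfloor>2 * v / \<beta>\<rfloor>)" by (simp add: less_Suc_eq_le)
  from ex_has_greatest_nat[of P, OF \<open>P {}\<close> this]
  obtain Z where Z: "P Z" and max: "\<And>Z'. P Z' \<Longrightarrow> card Z' \<le> card Z" by iprover
  have "\<exists>z\<in>Z. mdist d z x < 3" if "x \<in> D" for x
  proof (rule ccontr)
    assume *: "\<not> ?thesis"
    then have far: "mdist d z x \<ge> 2" "mdist d x z \<ge> 2" if "z \<in> Z" for z
      using that by (auto simp: not_less mdist_commute[of d x z] dest!: bspec[of _ _ z])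
    then have "x \<notin> Z" by fastforce
    have "P (insert x Z)"
      unfolding P_def
    proof (intro conjI ballI impI)
      fix z z' assume "z \<in> insert x Z" "z' \<in> insert x Z" "z \<noteq> z'"
      then consider "z = x" "z' \<in> Z" | "z \<in> Z" "z' = x" | "z \<in> Z" "z' \<in> Z" "z \<noteq> z'" by blast
      then show "mdist d z z' \<ge> 2" using far Z by cases (auto simp: P_def)
    qed (use Z \<open>x \<in> D\<close> in \<open>auto simp: P_def\<close>)
    from max[OF this] show False using \<open>x \<notin> Z\<close> Z by (simp add: P_def)
  qed
  then show ?thesis using Z bound[OF Z] by (auto simp: P_def \<beta>_def)
qed

lemma thick_support:
  assumes p: "1 \<le> p"
  obtains c c' :: real where "c > 0" "c' > 0"
    "\<And>f A v. f \<in> borel_measurable borel \<Longrightarrow> Lp_energy p lam f < \<infinity> \<Longrightarrow> A \<in> sets borel \<Longrightarrow>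
      emeasure lam A \<le> ennreal v \<Longrightarrow> 0 \<le> v \<Longrightarrow> (\<And>x. x \<notin> A \<Longrightarrow> f x = 0) \<Longrightarrow>
      ennreal c * energy p f \<le> Lp_energy p lam f \<Longrightarrow>
      \<exists>f' Z. f' \<in> borel_measurable borel \<and> Lp_energy p lam f' < \<infinity> \<and>
        Lp_energy p lam f \<le> ennreal c' * Lp_energy p lam f' \<and> energy p f' \<le> ennreal c' * energy p f \<and>
        finite Z \<and> real (card Z) \<le> 2 * v / measure lam (mball_of d 0 1) \<and>
        (\<forall>x. f' x \<noteq> 0 \<longrightarrow> (\<exists>z\<in>Z. mdist d z x < 3))"
proof -
  interpret sigma_finite_measure lam by (rule sigma_finite_lam)
  obtain n where n: "\<And>x. mdist d 0 x \<le> 1 \<Longrightarrow> word_length S x \<le> n"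
    using word_length_bounded[of 1] by blast
  define a where "a = 2 powr p"
  define k where "k = 2 * real n powr p"
  have a: "a \<ge> 1" using p ge_one_powr_ge_zero[of 2 p] by (simp add: a_def)
  have k: "k \<ge> 0" by (simp add: k_def)
  \<comment> \<open>The removed part contributes at most \<open>a * k * q\<close> to
    \<open>x\<close>, where \<open>q\<close> is the gradient term; with this \<open>c\<close> that
    is at most half of \<open>x\<close>, so \<open>x \<le> 2 * a * x'\<close>. The added 1 keeps
    \<open>c\<close> positive when \<open>k = 0\<close>. The two summands of \<open>c'\<close> serve
    the norm and the gradient respectively.\<close>
  define c where "c = 2 * a * k + 1"
  define c' where "c' = 2 * a + a * (1 + a * 2 * k)"
  have c: "c > 0" "c' > 0"
  proof -
    have "a * k \<ge> 0" "a * (1 + a * 2 * k) \<ge> 0" using a k by auto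
    then show "c > 0" "c' > 0" using a unfolding c_def c'_def by linarith+
  qed
  show ?thesis
  proof (rule that[OF c])
    fix f A v
    assume f [measurable]: "f \<in> borel_measurable borel" and fin: "Lp_energy p lam f < \<infinity>"
      and A [measurable]: "A \<in> sets borel" and v: "emeasure lam A \<le> ennreal v" "0 \<le> v"
      and fA: "\<And>x. x \<notin> A \<Longrightarrow> f x = 0" and large: "ennreal c * energy p f \<le> Lp_energy p lam f"
    define D where "D = {g. emeasure lam (mball_of d 0 1)
      \<le> 2 * (\<integral>\<^sup>+ x. indicator (mball_of d 0 1) x * indicator A (g + x) \<partial>lam)}"
    have [measurable]: "D \<in> sets borel" unfolding D_def by measurable
    define f' where "f' g = (if g \<in> D then f g else 0)" for g
    define e where "e g = (if g \<in> D then 0 else f g)" for g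
    have [measurable]: "f' \<in> borel_measurable borel" "e \<in> borel_measurable borel"
      unfolding f'_def e_def by measurable
    have e: "Lp_energy p lam e \<le> ennreal k * energy p f"
      unfolding e_def k_def
    proof (rule Lp_energy_low_density_le[OF p f A fA _ \<open>D \<in> sets borel\<close>])
      show "word_length S x \<le> n" if "mdist d 0 x < 1" for x using n[of x] that by simp
      show "2 * (\<integral>\<^sup>+ x. indicator (mball_of d 0 1) x * indicator A (g + x) \<partial>lam) < emeasure lam (mball_of d 0 1)"
        if "g \<notin> D" for g using that unfolding D_def by (simp only: mem_Collect_eq not_le)
    qed
    obtain Z where Z: "finite Z" "real (card Z) \<le> 2 * v / measure lam (mball_of d 0 1)"
        "\<forall>x\<in>D. \<exists>z\<in>Z. mdist d z x < 3"
    proof -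
      have "emeasure lam (mball_of d 0 1)
          \<le> 2 * (\<integral>\<^sup>+ x. indicator (mball_of d 0 1) x * indicator A (g + x) \<partial>lam)" if "g \<in> D" for g
        using that unfolding D_def by (simp only: mem_Collect_eq)
      from high_density_covering[OF A v this] show ?thesis using that by blast
    qed
    have "Lp_energy p lam f' \<le> Lp_energy p lam f"
      unfolding Lp_energy_def f'_def by (intro nn_integral_mono) auto
    then have fin': "Lp_energy p lam f' < \<infinity>" using fin by simp
    have f_eq: "Lp_energy p lam f = Lp_energy p lam (\<lambda>x. f' x + e x)"
      by (rule arg_cong[where f = "Lp_energy p lam"]) (auto simp: f'_def e_def)
    define X where "X = Lp_energy p lam f"
    define X' where "X' = Lp_energy p lam f'"
    define Q where "Q = energy p f"
    have "X \<le> ennreal a * (X' + Lp_energy p lam e)"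
      unfolding X_def X'_def a_def f_eq by (intro Lp_energy_add_le p) measurable
    also have "\<dots> \<le> ennreal a * (X' + ennreal k * Q)"
      using e by (intro mult_left_mono add_left_mono) (auto simp: Q_def)
    finally have X: "X \<le> ennreal a * (X' + ennreal k * Q)" .
    obtain x where x: "X = ennreal x" "x \<ge> 0" using fin by (cases X) (auto simp: X_def)
    obtain x' where x': "X' = ennreal x'" "x' \<ge> 0" using fin' by (cases X') (auto simp: X'_def)
    have "ennreal c * Q < top" using large fin by (simp add: Q_def le_less_trans)
    then obtain q where q: "Q = ennreal q" "q \<ge> 0" using c by (cases Q) (auto simp: ennreal_mult_top)
    have "ennreal x \<le> ennreal (a * (x' + k * q))"
      using X x x' q a k by (simp add: ennreal_mult ennreal_plus)
    then have 1: "x \<le> a * (x' + k * q)" using x' q a k by simp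
    have "ennreal (c * q) \<le> ennreal x"
      using large x q c by (simp add: ennreal_mult X_def[symmetric] Q_def[symmetric])
    then have 2: "(2 * a * k + 1) * q \<le> x" using x by (simp add: c_def)
    have "x \<le> 2 * a * x'" using 1 2 q by (simp add: algebra_simps)
    also have "\<dots> \<le> c' * x'" using a k x' by (intro mult_right_mono) (simp_all add: c'_def)
    finally have XX': "X \<le> ennreal c' * X'"
      using x x' c by (simp add: ennreal_mult[symmetric])
    have "energy p f' \<le> ennreal (a * (1 + a * 2 * k)) * Q"
      unfolding energy_def
    proof (rule SUP_least)
      fix t assume t: "t \<in> S"
      \<comment> \<open>Since \<open>f' = f - e\<close>, the cutoff needs no regularity: the
        gradient of \<open>e\<close> is bounded by its norm, which the gradient of \<open>f\<close>
        already controls.\<close>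
      have "Lp_energy p lam (\<lambda>x. f' x - f' (x + t)) = Lp_energy p lam (\<lambda>x. (f x - f (x + t)) - (e x - e (x + t)))"
        by (rule arg_cong[where f = "Lp_energy p lam"]) (auto simp: f'_def e_def)
      also have "\<dots> \<le> ennreal a * (Lp_energy p lam (\<lambda>x. f x - f (x + t)) + Lp_energy p lam (\<lambda>x. e x - e (x + t)))"
        unfolding a_def by (intro Lp_energy_diff_le p) measurable
      also have "\<dots> \<le> ennreal a * (Q + ennreal (a * 2) * (ennreal k * Q))"
      proof (intro mult_left_mono add_mono)
        show "Lp_energy p lam (\<lambda>x. f x - f (x + t)) \<le> Q" unfolding Q_def by (rule energy_upper[OF t])
        have "Lp_energy p lam (\<lambda>x. e x - e (x + t)) \<le> ennreal (a * 2) * Lp_energy p lam e"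
          unfolding a_def by (rule order_trans[OF energy_upper[OF t] energy_le[OF p]]) measurable
        also have "\<dots> \<le> ennreal (a * 2) * (ennreal k * Q)"
          using e by (intro mult_left_mono) (auto simp: Q_def)
        finally show "Lp_energy p lam (\<lambda>x. e x - e (x + t)) \<le> ennreal (a * 2) * (ennreal k * Q)" .
      qed simp
      also have "\<dots> = ennreal (a * (1 + a * 2 * k)) * Q"
      proof -
        have "ennreal a * (Q + ennreal (a * 2) * (ennreal k * Q)) = ennreal (a * (q + a * 2 * (k * q)))"
          using a k q by (simp add: ennreal_mult)
        also have "a * (q + a * 2 * (k * q)) = a * (1 + a * 2 * k) * q" by (simp add: algebra_simps)
        also have "ennreal \<dots> = ennreal (a * (1 + a * 2 * k)) * Q"
          unfolding q(1) using a k q(2) by (intro ennreal_mult) auto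
        finally show ?thesis .
      qed
      finally show "Lp_energy p lam (\<lambda>x. f' x - f' (x + t)) \<le> ennreal (a * (1 + a * 2 * k)) * Q" .
    qed
    also have "\<dots> \<le> ennreal c' * Q" using a by (intro mult_right_mono ennreal_leI) (simp_all add: c'_def)
    finally have "energy p f' \<le> ennreal c' * Q" .
    then show "\<exists>f' Z. f' \<in> borel_measurable borel \<and> Lp_energy p lam f' < \<infinity> \<and>
        Lp_energy p lam f \<le> ennreal c' * Lp_energy p lam f' \<and> energy p f' \<le> ennreal c' * energy p f \<and>
        finite Z \<and> real (card Z) \<le> 2 * v / measure lam (mball_of d 0 1) \<and>
        (\<forall>x. f' x \<noteq> 0 \<longrightarrow> (\<exists>z\<in>Z. mdist d z x < 3))"
      using fin' XX' Z by (intro exI[of _ f'] exI[of _ Z]) (auto simp: X_def X'_def Q_def f'_def)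
  qed
qed

section \<open>Averaged gradients and a lower bound for the profile\<close>

text \<open>Replaces the supremum over the generators, which cannot be exchanged with an integral, by an average.\<close>

lemma energy_le_average:
  assumes p: "1 \<le> p"
  obtains c r :: real where "c > 0"
    "\<And>f :: 'g \<Rightarrow> real. f \<in> borel_measurable borel \<Longrightarrow> energy p f
      \<le> ennreal c * (\<integral>\<^sup>+ u. indicator (mcball_of d 0 r) u * Lp_energy p lam (\<lambda>x. f x - f (x + u)) \<partial>lam)"
proof -
  interpret sigma_finite_measure lam by (rule sigma_finite_lam)
  obtain R where R: "\<And>t. t \<in> S \<Longrightarrow> mdist d 0 t \<le> R" using generators_bounded by blast
  \<comment> \<open>For \<open>u\<close> in the unit ball and \<open>t\<close> a generator, both
    \<open>u\<close> and \<open>- u + t\<close> lie in the ball of radius \<open>r\<close>.\<close>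
  define r where "r = max 1 (1 + R)"
  define \<beta> where "\<beta> = measure lam (mball_of d 0 1)"
  have \<beta>: "emeasure lam (mball_of d 0 1) = ennreal \<beta>"
    using emeasure_mball[of 0 1] unfolding \<beta>_def by (intro emeasure_eq_ennreal_measure) auto
  have \<beta>0: "\<beta> > 0" using emeasure_mball_pos[of 1] by (simp add: \<beta>)
  have c: "1 / \<beta> * (2 powr p * 2) > 0" using \<beta>0 by simp
  show ?thesis
  proof (rule that[OF c])
    fix f :: "'g \<Rightarrow> real" assume f [measurable]: "f \<in> borel_measurable borel"
    define F where "F u = Lp_energy p lam (\<lambda>x. f x - f (x + u))" for u
    have [measurable]: "F \<in> borel_measurable borel"
      unfolding F_def Lp_energy_def by measurable
    define I where "I = (\<integral>\<^sup>+ u. indicator (mcball_of d 0 r) u * F u \<partial>lam)"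
    show "energy p f \<le> ennreal (1 / \<beta> * (2 powr p * 2)) *
        (\<integral>\<^sup>+ u. indicator (mcball_of d 0 r) u * Lp_energy p lam (\<lambda>x. f x - f (x + u)) \<partial>lam)"
      unfolding energy_def F_def[symmetric] I_def[symmetric]
    proof (rule SUP_least)
      fix t assume t: "t \<in> S"
      \<comment> \<open>Translation by \<open>t\<close> is split at an arbitrary intermediate
        \<open>u\<close>; right invariance identifies the second difference with
        \<open>F (- u + t)\<close>. Integrating over \<open>u\<close> in the unit ball trades the
        single translate \<open>t\<close> for averages.\<close>
      have F_le: "F t \<le> ennreal (2 powr p) * (F u + F (- u + t))" for u
      proof -
        have "F t = Lp_energy p lam (\<lambda>x. (f x - f (x + u)) + (f (x + u) - f (x + t)))"
          by (simp add: F_def)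
        also have "\<dots> \<le> ennreal (2 powr p) * (F u + Lp_energy p lam (\<lambda>x. f (x + u) - f (x + t)))"
          unfolding F_def by (intro Lp_energy_add_le p) measurable
        also have "Lp_energy p lam (\<lambda>x. f (x + u) - f (x + t)) = F (- u + t)"
        proof -
          have eq: "x + u + (- u + t) = x + t" for x by (simp add: add.assoc)
          have "Lp_energy p lam (\<lambda>x. f (x + u) - f (x + t))
              = Lp_energy p lam (\<lambda>x. f (x + u) - f (x + u + (- u + t)))" by (simp only: eq)
          also have "\<dots> = F (- u + t)" unfolding F_def by (rule Lp_energy_right) measurable
          finally show ?thesis .
        qed
        finally show ?thesis .
      qed
      have "ennreal \<beta> * F t = (\<integral>\<^sup>+ u. indicator (mball_of d 0 1) u * F t \<partial>lam)"
        by (simp add: nn_integral_multc \<beta>)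
      also have "\<dots> \<le> (\<integral>\<^sup>+ u. ennreal (2 powr p) * (indicator (mcball_of d 0 r) u * F u
          + indicator (mcball_of d 0 r) (- u + t) * F (- u + t)) \<partial>lam)"
      proof (intro nn_integral_mono)
        fix u
        have "u \<in> mcball_of d 0 r \<and> - u + t \<in> mcball_of d 0 r" if "u \<in> mball_of d 0 1"
          using that R[OF t] mdist_triangle[of u d 0 t]
          by (auto simp: r_def dist_eq[of u t, symmetric] mdist_commute[of d u 0])
        then show "indicator (mball_of d 0 1) u * F t \<le> ennreal (2 powr p) *
            (indicator (mcball_of d 0 r) u * F u + indicator (mcball_of d 0 r) (- u + t) * F (- u + t))"
          using F_le[of u] by (cases "u \<in> mball_of d 0 1") auto
      qed
      also have "\<dots> = ennreal (2 powr p) * (I + (\<integral>\<^sup>+ u. indicator (mcball_of d 0 r) (- u + t) * F (- u + t) \<partial>lam))"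
        by (simp add: nn_integral_cmult nn_integral_add I_def)
      \<comment> \<open>Inversion followed by right translation by \<open>t\<close> preserves Haar
        measure, so both averages coincide.\<close>
      also have "(\<integral>\<^sup>+ u. indicator (mcball_of d 0 r) (- u + t) * F (- u + t) \<partial>lam) = I"
        using nn_integral_uminus[of "\<lambda>u. indicator (mcball_of d 0 r) (u + t) * F (u + t)"]
          nn_integral_right[of "\<lambda>u. indicator (mcball_of d 0 r) u * F u" t] by (simp add: I_def)
      finally have le: "ennreal \<beta> * F t \<le> ennreal (2 powr p * 2) * I"
        by (simp add: ennreal_mult mult_2 mult.assoc)
      have "F t = ennreal (1 / \<beta>) * (ennreal \<beta> * F t)"
        using \<beta>0 by (simp add: mult.assoc[symmetric] ennreal_mult[symmetric])
      also have "\<dots> \<le> ennreal (1 / \<beta>) * (ennreal (2 powr p * 2) * I)"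
        by (intro mult_left_mono le) simp
      also have "\<dots> = ennreal (1 / \<beta> * (2 powr p * 2)) * I"
        using \<beta>0 by (subst ennreal_mult) (auto simp: mult.assoc)
      finally show "F t \<le> ennreal (1 / \<beta> * (2 powr p * 2)) * I" .
    qed
  qed
qed

lemma emeasure_mball_eq: "emeasure lam (mball_of d x r) = emeasure lam (mball_of d 0 r)"
proof -
  have "mball_of d x r = {y. - x + y \<in> mball_of d 0 r}" by (auto simp: dist_eq[of x])
  then show ?thesis using emeasure_left[of "mball_of d 0 r" "- x"] by simp
qed

text \<open>The indicator of the unit ball is a test function for all \<open>v\<close> at least the
  mass of that ball, and its gradient is bounded by its norm. The resulting constant is the
  benchmark for functions on \<open>G\<close> whose gradient is too large for the cutoff.\<close>

lemma isop_profile_pos: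
  assumes p: "1 \<le> p"
  shows "\<exists>c>0. \<exists>v0. \<forall>v\<ge>v0. ennreal c \<le> isop_profile p S lam v"
proof -
  define f :: "'g \<Rightarrow> real" where "f = indicator (mball_of d 0 1)"
  have [measurable]: "f \<in> borel_measurable borel" by (simp add: f_def)
  have E: "Lp_energy p lam f = emeasure lam (mball_of d 0 1)"
  proof -
    have "Lp_energy p lam f = (\<integral>\<^sup>+ x. indicator (mball_of d 0 1) x \<partial>lam)"
      unfolding Lp_energy_def f_def by (intro nn_integral_cong) (auto split: split_indicator)
    then show ?thesis by simp
  qed
  have nz: "Lp_energy p lam f \<noteq> 0" "Lp_energy p lam f < \<infinity>"
    using emeasure_mball_pos[of 1] emeasure_mball[of 0 1] by (auto simp: E)
  define k where "k = 2 powr p * 2"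
  have k: "k > 0" by (simp add: k_def)
  have "1 / ennreal k \<le> ennreal 1 * (Lp_energy p lam f / energy p f)"
    by (rule ennreal_ratio_le) (use nz energy_le[OF p, of f] in \<open>auto simp: k_def\<close>)
  then have "epowr (1 / p) (ennreal (1 / k)) \<le> epowr (1 / p) (Lp_energy p lam f / energy p f)"
    using p k by (intro epowr_mono) (auto simp: divide_ennreal[symmetric])
  then have le: "ennreal ((1 / k) powr (1 / p)) \<le> epowr (1 / p) (Lp_energy p lam f / energy p f)"
    using k by (simp add: epowr_ennreal)
  show ?thesis
  proof (intro exI conjI allI impI)
    show "(1 / k) powr (1 / p) > 0" using k by simp
    fix v assume v: "v \<ge> measure lam (mball_of d 0 1)"
    have "emeasure lam (mball_of d 0 1) = ennreal (measure lam (mball_of d 0 1))"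
      using emeasure_mball[of 0 1] by (intro emeasure_eq_ennreal_measure) auto
    also have "\<dots> \<le> ennreal v" using v by (rule ennreal_leI)
    finally show "ennreal ((1 / k) powr (1 / p)) \<le> isop_profile p S lam v"
      by (intro order_trans[OF le isop_profile_ge[OF p _ nz(2,1), of "mball_of d 0 1"]])
        (auto simp: f_def split: split_indicator)
  qed
qed

end

section \<open>Transfer along a coupling\<close>

lemma fundamental_domain_subset: "fundamental_domain M act F \<Longrightarrow> F \<subseteq> space M"
  by (auto simp: fundamental_domain_def dest: measurable_space)

locale subgroup_coupling =
  H: unimodular_group SH dH lamH + G: unimodular_group SG dG lamG
  for SH :: "'h::{topological_group_add, t2_space, second_countable_topology} set"
    and dH :: "'h metric" and lamH :: "'h measure"
    and SG :: "'g::{topological_group_add, t2_space, second_countable_topology} set"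
    and dG :: "'g metric" and lamG :: "'g measure" +
  fixes p :: real and \<mu> :: "'a measure"
    and actH :: "'h \<Rightarrow> 'a \<Rightarrow> 'a" and actG :: "'g \<Rightarrow> 'a \<Rightarrow> 'a"
    and FH FG :: "'a set" and \<nu>H \<nu>G :: "'a measure"
  assumes p: "1 \<le> p"
    and coupling: "measure_subgroup_coupling lamH lamG \<mu> actH actG FH FG \<nu>H \<nu>G"
    and Lp_coupling: "Lp_coupling p SH SG actH actG FG \<nu>G"
begin

lemma actH_measurable: "(\<lambda>(h, x). actH h x) \<in> borel \<Otimes>\<^sub>M \<mu> \<rightarrow>\<^sub>M \<mu>"
  and actG_measurable: "(\<lambda>(g, x). actG g x) \<in> borel \<Otimes>\<^sub>M \<mu> \<rightarrow>\<^sub>M \<mu>"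
  and actG_0: "\<omega> \<in> space \<mu> \<Longrightarrow> actG 0 \<omega> = \<omega>"
  and actH_add: "\<omega> \<in> space \<mu> \<Longrightarrow> actH (h + h') \<omega> = actH h (actH h' \<omega>)"
  and actG_add: "\<omega> \<in> space \<mu> \<Longrightarrow> actG (g + g') \<omega> = actG g (actG g' \<omega>)"
  and act_commute: "\<omega> \<in> space \<mu> \<Longrightarrow> actH h (actG g \<omega>) = actG g (actH h \<omega>)"
  and FH: "FH \<subseteq> space \<mu>" and FG: "FG \<subseteq> space \<mu>"
  and sets_\<nu>H: "sets \<nu>H = sets (restrict_space \<mu> FH)"
  and sets_\<nu>G: "sets \<nu>G = sets (restrict_space \<mu> FG)"
  and sigma_finite_\<nu>H: "sigma_finite_measure \<nu>H" and finite_\<nu>G: "finite_measure \<nu>G"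
  and isoG: "measure_space_iso (lamG \<Otimes>\<^sub>M \<nu>G) \<mu> (\<lambda>(g, x). actG g x)"
  and isoH: "measure_space_iso (lamH \<Otimes>\<^sub>M \<nu>H) \<mu> (\<lambda>(h, x). actH h x)"
  and nonzero: "emeasure \<mu> (space \<mu>) \<noteq> 0"
  using coupling fundamental_domain_subset
  unfolding measure_subgroup_coupling_def smooth_action_def borel_action_def by blast+

lemma space_\<nu>H [simp]: "space \<nu>H = FH"
  using sets_eq_imp_space_eq[OF sets_\<nu>H] FH by (auto simp: space_restrict_space)

lemma space_\<nu>G [simp]: "space \<nu>G = FG"
  using sets_eq_imp_space_eq[OF sets_\<nu>G] FG by (auto simp: space_restrict_space)

lemma measurable_actH [measurable (raw)]:
  assumes [measurable]: "f \<in> M \<rightarrow>\<^sub>M borel" "k \<in> M \<rightarrow>\<^sub>M \<mu>"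
  shows "(\<lambda>x. actH (f x) (k x)) \<in> M \<rightarrow>\<^sub>M \<mu>"
  using measurable_compose[OF measurable_Pair[OF assms] actH_measurable] by simp

lemma measurable_actG [measurable (raw)]:
  assumes [measurable]: "f \<in> M \<rightarrow>\<^sub>M borel" "k \<in> M \<rightarrow>\<^sub>M \<mu>"
  shows "(\<lambda>x. actG (f x) (k x)) \<in> M \<rightarrow>\<^sub>M \<mu>"
  using measurable_compose[OF measurable_Pair[OF assms] actG_measurable] by simp

lemma actH_space: "\<omega> \<in> space \<mu> \<Longrightarrow> actH h \<omega> \<in> space \<mu>"
  using measurable_space[OF measurable_actH[of "\<lambda>_. h" \<mu> "\<lambda>x. x"]] by simp

lemma measurable_into_\<nu>H [measurable]: "(\<lambda>x. x) \<in> \<nu>H \<rightarrow>\<^sub>M \<mu>"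
  unfolding measurable_cong_sets[OF sets_\<nu>H refl] by (intro measurable_restrict_space1) simp

lemma measurable_into_\<nu>G [measurable]: "(\<lambda>x. x) \<in> \<nu>G \<rightarrow>\<^sub>M \<mu>"
  unfolding measurable_cong_sets[OF sets_\<nu>G refl] by (intro measurable_restrict_space1) simp

lemma measurable_\<nu>H [measurable (raw)]: "f \<in> M \<rightarrow>\<^sub>M \<nu>H \<Longrightarrow> f \<in> M \<rightarrow>\<^sub>M \<mu>"
  by (rule measurable_compose[OF _ measurable_into_\<nu>H])

lemma measurable_\<nu>G [measurable (raw)]: "f \<in> M \<rightarrow>\<^sub>M \<nu>G \<Longrightarrow> f \<in> M \<rightarrow>\<^sub>M \<mu>"
  by (rule measurable_compose[OF _ measurable_into_\<nu>G])

section \<open>The \<open>G\<close>-coordinate and the cocycle\<close>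

lemma bij_G: "bij_betw (\<lambda>(g, x). actG g x) (UNIV \<times> FG) (space \<mu>)"
  using isoG by (simp add: measure_space_iso_def space_pair_measure)

definition proj :: "'a \<Rightarrow> 'g" where
  "proj \<omega> = fst (inv_into (UNIV \<times> FG) (\<lambda>(g, x). actG g x) \<omega>)"

lemma proj_measurable [measurable]: "proj \<in> \<mu> \<rightarrow>\<^sub>M borel"
proof -
  have "inv_into (UNIV \<times> FG) (\<lambda>(g, x). actG g x) \<in> \<mu> \<rightarrow>\<^sub>M lamG \<Otimes>\<^sub>M \<nu>G"
    using isoG by (simp add: measure_space_iso_def space_pair_measure)
  from measurable_compose[OF this measurable_fst] show ?thesis
    by (simp add: proj_def[abs_def] measurable_cong_sets[OF refl G.sets_lam])
qed

lemma actG_inj: "x \<in> FG \<Longrightarrow> y \<in> FG \<Longrightarrow> actG g x = actG g' y \<Longrightarrow> g = g' \<and> x = y"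
  using bij_G by (auto simp: bij_betw_def dest: inj_onD[of _ _ "(g, x)" "(g', y)"])

lemma proj_act: "x \<in> FG \<Longrightarrow> proj (actG g x) = g"
  using bij_betw_inv_into_left[OF bij_G, of "(g, x)"] by (simp add: proj_def)

lemma ex_representation:
  assumes "\<omega> \<in> space \<mu>"
  shows "\<exists>x\<in>FG. \<omega> = actG (proj \<omega>) x"
proof -
  have "\<omega> \<in> (\<lambda>(g, x). actG g x) ` (UNIV \<times> FG)"
    using assms bij_G by (simp add: bij_betw_def)
  then obtain g x where "x \<in> FG" "\<omega> = actG g x" by auto
  then show ?thesis by (auto simp: proj_act)
qed

lemma proj_actG:
  assumes "\<omega> \<in> space \<mu>"
  shows "proj (actG g \<omega>) = g + proj \<omega>"
proof -
  obtain x where x: "x \<in> FG" "\<omega> = actG (proj \<omega>) x" using ex_representation[OF assms] by blast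
  have "actG (g + proj \<omega>) x = actG g (actG (proj \<omega>) x)" using x FG by (intro actG_add) auto
  then have "actG g \<omega> = actG (g + proj \<omega>) x" by (simp only: x(2)[symmetric])
  then show ?thesis using x by (simp add: proj_act)
qed

text \<open>The induced point and the cocycle value are the two coordinates of
  \<open>actH h x\<close> in \<open>UNIV \<times> FG\<close>. This replaces definite descriptions by
  \<open>proj\<close>, which is measurable as part of the inverse of the coupling
  isomorphism.\<close>

lemma cocycle_eq:
  assumes "x \<in> FG"
  shows "cocycle actH actG FG h x = proj (actH h x)"
proof -
  define \<omega> where "\<omega> = actH h x"
  have \<omega>: "\<omega> \<in> space \<mu>" using assms FG by (auto simp: \<omega>_def intro: actH_space)
  obtain y where y: "y \<in> FG" "\<omega> = actG (proj \<omega>) y" using ex_representation[OF \<omega>] by blast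
  have rep: "actG g \<omega> = actG (g + proj \<omega>) y" for g
  proof -
    have "actG (g + proj \<omega>) y = actG g (actG (proj \<omega>) y)" using y FG by (intro actG_add) auto
    then show ?thesis by (simp only: y(2)[symmetric])
  qed
  have "induced_action actH actG FG h x = y"
    unfolding induced_action_def \<omega>_def[symmetric]
  proof (rule the_equality)
    have "actG (- proj \<omega>) \<omega> = actG (- proj \<omega> + proj \<omega>) y" by (rule rep)
    then have "y = actG (- proj \<omega>) \<omega>" using y FG by (auto simp: actG_0)
    then show "y \<in> FG \<and> y \<in> orbit actG \<omega>" using y by (auto simp: orbit_def)
    fix y' assume y': "y' \<in> FG \<and> y' \<in> orbit actG \<omega>"
    then obtain g where "y' = actG g \<omega>" by (auto simp: orbit_def)
    also have "\<dots> = actG (g + proj \<omega>) y" by (rule rep)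
    finally have "actG 0 y' = actG (g + proj \<omega>) y" using y' FG by (auto simp: actG_0)
    then show "y' = y" using actG_inj y y' by blast
  qed
  then show ?thesis
    unfolding cocycle_def \<omega>_def[symmetric] using y actG_inj by (auto intro!: the_equality)
qed

lemma pair_sigma_finite_G: "pair_sigma_finite lamG \<nu>G"
  using G.sigma_finite_lam finite_\<nu>G by (simp add: pair_sigma_finite_def finite_measure_def)

lemma pair_sigma_finite_H: "pair_sigma_finite lamH \<nu>H"
  using H.sigma_finite_lam sigma_finite_\<nu>H by (simp add: pair_sigma_finite_def)

section \<open>Integration over the coupling space in its two coordinate systems\<close>

lemma nn_integral_coupling_G:
  assumes [measurable]: "\<phi> \<in> borel_measurable \<mu>"
  shows "(\<integral>\<^sup>+ \<omega>. \<phi> \<omega> \<partial>\<mu>) = (\<integral>\<^sup>+ x. \<integral>\<^sup>+ g. \<phi> (actG g x) \<partial>lamG \<partial>\<nu>G)"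
proof -
  interpret pair_sigma_finite lamG \<nu>G by (rule pair_sigma_finite_G)
  have m: "(\<lambda>(g, x). actG g x) \<in> lamG \<Otimes>\<^sub>M \<nu>G \<rightarrow>\<^sub>M \<mu>"
    and d: "distr (lamG \<Otimes>\<^sub>M \<nu>G) \<mu> (\<lambda>(g, x). actG g x) = \<mu>"
    using isoG by (auto simp: measure_space_iso_def)
  have "(\<integral>\<^sup>+ \<omega>. \<phi> \<omega> \<partial>\<mu>) = (\<integral>\<^sup>+ z. \<phi> (case z of (g, x) \<Rightarrow> actG g x) \<partial>(lamG \<Otimes>\<^sub>M \<nu>G))"
    by (subst d[symmetric], rule nn_integral_distr[OF m]) simp
  also have "\<dots> = (\<integral>\<^sup>+ x. \<integral>\<^sup>+ g. \<phi> (actG g x) \<partial>lamG \<partial>\<nu>G)"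
    using measurable_compose[OF m assms] by (subst nn_integral_snd[symmetric]) simp_all
  finally show ?thesis .
qed

text \<open>The inverse, permitted by unimodularity of \<open>H\<close>, makes right translation of
  \<open>h\<close> by \<open>k\<close> correspond to the action of \<open>- k\<close> on the point
  \<open>actH (- h) y\<close>.\<close>

lemma nn_integral_coupling_H:
  assumes [measurable]: "\<phi> \<in> borel_measurable \<mu>"
  shows "(\<integral>\<^sup>+ \<omega>. \<phi> \<omega> \<partial>\<mu>) = (\<integral>\<^sup>+ y. \<integral>\<^sup>+ h. \<phi> (actH (- h) y) \<partial>lamH \<partial>\<nu>H)"
proof -
  interpret pair_sigma_finite lamH \<nu>H by (rule pair_sigma_finite_H)
  have m: "(\<lambda>(h, x). actH h x) \<in> lamH \<Otimes>\<^sub>M \<nu>H \<rightarrow>\<^sub>M \<mu>"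
    and d: "distr (lamH \<Otimes>\<^sub>M \<nu>H) \<mu> (\<lambda>(h, x). actH h x) = \<mu>"
    using isoH by (auto simp: measure_space_iso_def)
  have "(\<integral>\<^sup>+ \<omega>. \<phi> \<omega> \<partial>\<mu>) = (\<integral>\<^sup>+ z. \<phi> (case z of (h, x) \<Rightarrow> actH h x) \<partial>(lamH \<Otimes>\<^sub>M \<nu>H))"
    by (subst d[symmetric], rule nn_integral_distr[OF m]) simp
  also have "\<dots> = (\<integral>\<^sup>+ y. \<integral>\<^sup>+ h. \<phi> (actH h y) \<partial>lamH \<partial>\<nu>H)"
    using measurable_compose[OF m assms] by (subst nn_integral_snd[symmetric]) simp_all
  also have "\<dots> = (\<integral>\<^sup>+ y. \<integral>\<^sup>+ h. \<phi> (actH (- h) y) \<partial>lamH \<partial>\<nu>H)"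
  proof (rule nn_integral_cong)
    fix y assume "y \<in> space \<nu>H"
    then have [measurable]: "(\<lambda>_::'h. y) \<in> borel \<rightarrow>\<^sub>M \<mu>" using FH by auto
    show "(\<integral>\<^sup>+ h. \<phi> (actH h y) \<partial>lamH) = (\<integral>\<^sup>+ h. \<phi> (actH (- h) y) \<partial>lamH)"
      by (rule H.nn_integral_uminus[symmetric]) measurable
  qed
  finally show ?thesis .
qed

section \<open>Restrictions of lifted functions to \<open>H\<close>-orbits\<close>

definition transfer :: "('g \<Rightarrow> real) \<Rightarrow> 'a \<Rightarrow> 'h \<Rightarrow> real" where
  "transfer f y h = f (proj (actH (- h) y))"

lemma transfer_measurable [measurable (raw)]:
  assumes [measurable]: "f \<in> borel_measurable borel" "k \<in> M \<rightarrow>\<^sub>M \<mu>" "q \<in> M \<rightarrow>\<^sub>M borel"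
  shows "(\<lambda>x. transfer f (k x) (q x)) \<in> borel_measurable M"
  unfolding transfer_def by measurable

lemma transfer_measurable' [measurable]:
  assumes [measurable]: "f \<in> borel_measurable borel" and "y \<in> space \<mu>"
  shows "transfer f y \<in> borel_measurable borel"
proof -
  have [measurable]: "(\<lambda>_::'h. y) \<in> borel \<rightarrow>\<^sub>M \<mu>" using assms by auto
  have "(\<lambda>h. transfer f y h) \<in> borel_measurable borel" by measurable
  then show ?thesis by simp
qed

lemma nn_integral_Lp_energy_transfer:
  assumes [measurable]: "f \<in> borel_measurable borel"
  shows "(\<integral>\<^sup>+ y. Lp_energy p lamH (transfer f y) \<partial>\<nu>H) = Lp_energy p lamG f * emeasure \<nu>G FG"
proof -
  have "(\<integral>\<^sup>+ y. Lp_energy p lamH (transfer f y) \<partial>\<nu>H) = (\<integral>\<^sup>+ \<omega>. ennreal (\<bar>f (proj \<omega>)\<bar> powr p) \<partial>\<mu>)"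
    unfolding Lp_energy_def transfer_def by (rule nn_integral_coupling_H[symmetric]) measurable
  also have "\<dots> = (\<integral>\<^sup>+ x. \<integral>\<^sup>+ g. ennreal (\<bar>f (proj (actG g x))\<bar> powr p) \<partial>lamG \<partial>\<nu>G)"
    by (rule nn_integral_coupling_G) measurable
  also have "\<dots> = (\<integral>\<^sup>+ x. Lp_energy p lamG f \<partial>\<nu>G)"
    unfolding Lp_energy_def by (intro nn_integral_cong) (simp add: proj_act)
  finally show ?thesis by simp
qed

text \<open>Both sides integrate, over the coupling space, the difference of the lifted function
  between a point and its image under \<open>- k\<close>. As the actions commute, that image of
  \<open>actG g x\<close> has \<open>G\<close>-coordinate \<open>g\<close> times the cocycle value
  on the right, so a right gradient on \<open>H\<close> becomes right differences on
  \<open>G\<close>.\<close>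

lemma nn_integral_transfer_translate:
  assumes [measurable]: "f \<in> borel_measurable borel"
  shows "(\<integral>\<^sup>+ y. Lp_energy p lamH (\<lambda>h. transfer f y h - transfer f y (h + k)) \<partial>\<nu>H)
    = (\<integral>\<^sup>+ x. Lp_energy p lamG (\<lambda>g. f g - f (g + cocycle actH actG FG (- k) x)) \<partial>\<nu>G)"
proof -
  define \<psi> where "\<psi> \<omega> = ennreal (\<bar>f (proj \<omega>) - f (proj (actH (- k) \<omega>))\<bar> powr p)" for \<omega>
  have [measurable]: "\<psi> \<in> borel_measurable \<mu>" unfolding \<psi>_def by measurable
  have "(\<integral>\<^sup>+ y. Lp_energy p lamH (\<lambda>h. transfer f y h - transfer f y (h + k)) \<partial>\<nu>H)
      = (\<integral>\<^sup>+ y. \<integral>\<^sup>+ h. \<psi> (actH (- h) y) \<partial>lamH \<partial>\<nu>H)"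
    unfolding Lp_energy_def transfer_def \<psi>_def
  proof (intro nn_integral_cong)
    fix y h assume "y \<in> space \<nu>H"
    then have "actH (- (h + k)) y = actH (- k) (actH (- h) y)"
      using FH by (auto simp only: minus_add space_\<nu>H intro!: actH_add)
    then show "ennreal (\<bar>f (proj (actH (- h) y)) - f (proj (actH (- (h + k)) y))\<bar> powr p)
        = ennreal (\<bar>f (proj (actH (- h) y)) - f (proj (actH (- k) (actH (- h) y)))\<bar> powr p)" by simp
  qed
  also have "\<dots> = (\<integral>\<^sup>+ \<omega>. \<psi> \<omega> \<partial>\<mu>)" by (rule nn_integral_coupling_H[symmetric]) measurable
  also have "\<dots> = (\<integral>\<^sup>+ x. \<integral>\<^sup>+ g. \<psi> (actG g x) \<partial>lamG \<partial>\<nu>G)" by (rule nn_integral_coupling_G) measurable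
  also have "\<dots> = (\<integral>\<^sup>+ x. Lp_energy p lamG (\<lambda>g. f g - f (g + cocycle actH actG FG (- k) x)) \<partial>\<nu>G)"
    unfolding Lp_energy_def \<psi>_def
  proof (intro nn_integral_cong)
    fix x g assume "x \<in> space \<nu>G"
    then have x: "x \<in> FG" "x \<in> space \<mu>" using FG by auto
    then have "proj (actH (- k) (actG g x)) = g + cocycle actH actG FG (- k) x"
      by (simp only: act_commute proj_actG actH_space cocycle_eq)
    then show "ennreal (\<bar>f (proj (actG g x)) - f (proj (actH (- k) (actG g x)))\<bar> powr p)
        = ennreal (\<bar>f g - f (g + cocycle actH actG FG (- k) x)\<bar> powr p)" using x by (simp add: proj_act)
  qed
  finally show ?thesis .
qed

text \<open>For each \<open>x\<close> the translate by the cocycle value costs the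
  \<open>p\<close>-th power of its length; integrating over \<open>FG\<close> leaves the
  \<open>p\<close>-th power of an \<open>L^p\<close> norm. The cocycle is evaluated at
  \<open>- k\<close>, which is again a generator by symmetry of \<open>SH\<close>.\<close>

lemma nn_integral_transfer_generator_le:
  obtains M :: real where "M \<ge> 0"
    "\<And>f k. f \<in> borel_measurable borel \<Longrightarrow> k \<in> SH \<Longrightarrow>
      (\<integral>\<^sup>+ y. Lp_energy p lamH (\<lambda>h. transfer f y h - transfer f y (h + k)) \<partial>\<nu>H) \<le> ennreal M * G.energy p f"
proof -
  define c where "c h x = real (word_length SG (cocycle actH actG FG h x))" for h x
  define B where "B = (SUP h\<in>SH. Lp_norm p \<nu>G (c h))"
  have "B < \<infinity>" using Lp_coupling by (simp add: Lp_coupling_def B_def c_def[abs_def])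
  then obtain M where M: "epowr p B = ennreal M" "M \<ge> 0"
    by (cases "epowr p B") auto
  have [measurable]: "c h \<in> borel_measurable \<nu>G" for h
  proof -
    have "(\<lambda>x. real (word_length SG (proj (actH h x)))) \<in> borel_measurable \<nu>G" by measurable
    then show ?thesis by (rule measurable_cong[THEN iffD1, rotated]) (simp add: c_def cocycle_eq)
  qed
  show ?thesis
  proof (rule that[OF M(2)])
    fix f :: "'g \<Rightarrow> real" and k assume f [measurable]: "f \<in> borel_measurable borel" and k: "k \<in> SH"
    have "Lp_norm p \<nu>G (c (- k)) \<le> B" unfolding B_def using H.uminus_gen[OF k] by (rule SUP_upper)
    from epowr_mono[OF _ this, of p] have "epowr p (Lp_norm p \<nu>G (c (- k))) \<le> ennreal M"
      using p by (simp add: M(1))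
    then have le: "Lp_energy p \<nu>G (c (- k)) \<le> ennreal M" using p by (simp add: Lp_norm_eq epowr_inverse)
    have "(\<integral>\<^sup>+ y. Lp_energy p lamH (\<lambda>h. transfer f y h - transfer f y (h + k)) \<partial>\<nu>H)
        \<le> (\<integral>\<^sup>+ x. ennreal (\<bar>c (- k) x\<bar> powr p) * G.energy p f \<partial>\<nu>G)"
      unfolding nn_integral_transfer_translate[OF f] c_def
      using G.Lp_energy_translate_le[OF p f] by (intro nn_integral_mono) simp
    also have "\<dots> = Lp_energy p \<nu>G (c (- k)) * G.energy p f"
      by (simp add: nn_integral_multc Lp_energy_def)
    also have "\<dots> \<le> ennreal M * G.energy p f" by (intro mult_right_mono le) simp
    finally show "(\<integral>\<^sup>+ y. Lp_energy p lamH (\<lambda>h. transfer f y h - transfer f y (h + k)) \<partial>\<nu>H)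
        \<le> ennreal M * G.energy p f" .
  qed
qed

text \<open>The average that replaces the gradient runs over a ball of \<open>H\<close>, so the
  bound for generators must be extended to it. Elements of the ball are words of bounded length, and
  the telescoping sum is taken for each \<open>y\<close> before integrating.\<close>

lemma nn_integral_transfer_bounded_le:
  obtains M :: real where "M \<ge> 0"
    "\<And>f k. f \<in> borel_measurable borel \<Longrightarrow> mdist dH 0 k \<le> r \<Longrightarrow>
      (\<integral>\<^sup>+ y. Lp_energy p lamH (\<lambda>h. transfer f y h - transfer f y (h + k)) \<partial>\<nu>H) \<le> ennreal M * G.energy p f"
proof -
  interpret sigma_finite_measure lamH by (rule H.sigma_finite_lam)
  obtain M where M: "M \<ge> 0" "\<And>f k. f \<in> borel_measurable borel \<Longrightarrow> k \<in> SH \<Longrightarrow>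
      (\<integral>\<^sup>+ y. Lp_energy p lamH (\<lambda>h. transfer f y h - transfer f y (h + k)) \<partial>\<nu>H) \<le> ennreal M * G.energy p f"
    by (rule nn_integral_transfer_generator_le) blast
  obtain n where n: "\<And>k. mdist dH 0 k \<le> r \<Longrightarrow> word_length SH k \<le> n"
    using H.word_length_bounded[of r] by blast
  have M': "real n powr (p - 1) * (real n * M) \<ge> 0" using M by simp
  show ?thesis
  proof (rule that[OF M'])
    fix f :: "'g \<Rightarrow> real" and k assume f [measurable]: "f \<in> borel_measurable borel" and k: "mdist dH 0 k \<le> r"
    obtain w where w: "length w = word_length SH k" "set w \<subseteq> SH" "sum_list w = k"
      using H.word_length_word by blast
    have lw: "length w \<le> n" using n[OF k] w by simp
    define \<Phi> where "\<Phi> k y = Lp_energy p lamH (\<lambda>h. transfer f y h - transfer f y (h + k))" for k y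
    have [measurable]: "\<Phi> k \<in> borel_measurable \<nu>H" for k
      unfolding \<Phi>_def Lp_energy_def by measurable
    have "(\<integral>\<^sup>+ y. \<Phi> k y \<partial>\<nu>H) \<le> (\<integral>\<^sup>+ y. ennreal (real n powr (p - 1)) * (\<Sum>i<length w. \<Phi> (w ! i) y) \<partial>\<nu>H)"
    proof (intro nn_integral_mono)
      fix y assume "y \<in> space \<nu>H"
      then have [measurable]: "transfer f y \<in> borel_measurable borel"
        using FH by (intro transfer_measurable') auto
      have "\<Phi> k y \<le> ennreal (real (length w) powr (p - 1)) * (\<Sum>t\<leftarrow>w. \<Phi> t y)"
        unfolding \<Phi>_def w(3)[symmetric] by (intro H.Lp_energy_word_le p) measurable
      also have "\<dots> \<le> ennreal (real n powr (p - 1)) * (\<Sum>t\<leftarrow>w. \<Phi> t y)"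
        using lw p by (intro mult_right_mono ennreal_leI powr_mono2) auto
      finally show "\<Phi> k y \<le> ennreal (real n powr (p - 1)) * (\<Sum>i<length w. \<Phi> (w ! i) y)"
        by (simp add: sum_list_sum_nth atLeast0LessThan)
    qed
    also have "\<dots> = ennreal (real n powr (p - 1)) * (\<Sum>i<length w. \<integral>\<^sup>+ y. \<Phi> (w ! i) y \<partial>\<nu>H)"
      by (simp add: nn_integral_cmult nn_integral_sum)
    also have "\<dots> \<le> ennreal (real n powr (p - 1)) * (\<Sum>i<length w. ennreal M * G.energy p f)"
      unfolding \<Phi>_def using w(2) by (intro mult_left_mono sum_mono M(2) f) auto
    also have "\<dots> \<le> ennreal (real n powr (p - 1)) * (ennreal (real n) * (ennreal M * G.energy p f))"
    proof (rule mult_left_mono)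
      have "ennreal (real (length w)) * (ennreal M * G.energy p f) \<le> ennreal (real n) * (ennreal M * G.energy p f)"
        using lw by (intro mult_right_mono ennreal_leI) simp_all
      then show "(\<Sum>i<length w. ennreal M * G.energy p f) \<le> ennreal (real n) * (ennreal M * G.energy p f)"
        by (simp add: ennreal_of_nat_eq_real_of_nat)
    qed simp
    also have "\<dots> = ennreal (real n powr (p - 1) * (real n * M)) * G.energy p f"
      using M(1) by (simp add: ennreal_mult mult.assoc)
    finally show "(\<integral>\<^sup>+ y. Lp_energy p lamH (\<lambda>h. transfer f y h - transfer f y (h + k)) \<partial>\<nu>H)
        \<le> ennreal (real n powr (p - 1) * (real n * M)) * G.energy p f" by (simp add: \<Phi>_def)
  qed
qed

lemma emeasure_\<nu>G: "emeasure \<nu>G FG \<noteq> 0" "emeasure \<nu>G FG < \<infinity>"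
proof -
  interpret finite_measure \<nu>G by (rule finite_\<nu>G)
  show "emeasure \<nu>G FG < \<infinity>" using emeasure_finite[of FG] by (simp add: less_top[symmetric])
  show "emeasure \<nu>G FG \<noteq> 0"
  proof
    assume 0: "emeasure \<nu>G FG = 0"
    have "emeasure \<mu> (space \<mu>) = (\<integral>\<^sup>+ \<omega>. 1 \<partial>\<mu>)" by simp
    also have "\<dots> = (\<integral>\<^sup>+ x. emeasure lamG UNIV \<partial>\<nu>G)" by (subst nn_integral_coupling_G) simp_all
    also have "\<dots> = 0" using 0 by simp
    finally show False using nonzero by simp
  qed
qed

text \<open>The supremum defining \<open>H.energy\<close> is replaced by the larger averaged
  quantity \<open>\<Phi>\<close>. Fubini moves the integral over \<open>y\<close> inside the
  average, where the bound for single translates applies, and the first moment argument then selects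
  one \<open>y\<close>.\<close>

lemma ex_good_transfer:
  obtains K :: real where "K > 0"
    "\<And>f. f \<in> borel_measurable borel \<Longrightarrow> Lp_energy p lamG f \<noteq> 0 \<Longrightarrow> Lp_energy p lamG f < \<infinity> \<Longrightarrow>
      \<exists>y\<in>FH. Lp_energy p lamH (transfer f y) \<noteq> 0 \<and> Lp_energy p lamH (transfer f y) < \<infinity> \<and>
        H.energy p (transfer f y) * Lp_energy p lamG f \<le> ennreal K * G.energy p f * Lp_energy p lamH (transfer f y)"
proof -
  interpret P: pair_sigma_finite lamH \<nu>H by (rule pair_sigma_finite_H)
  interpret sigma_finite_measure lamH by (rule H.sigma_finite_lam)
  obtain c r where c: "c > 0" and avg: "\<And>F. F \<in> borel_measurable borel \<Longrightarrow> H.energy p F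
      \<le> ennreal c * (\<integral>\<^sup>+ u. indicator (mcball_of dH 0 r) u * Lp_energy p lamH (\<lambda>x. F x - F (x + u)) \<partial>lamH)"
    by (rule H.energy_le_average[OF p]) blast
  obtain M where M: "M \<ge> 0" "\<And>f k. f \<in> borel_measurable borel \<Longrightarrow> mdist dH 0 k \<le> r \<Longrightarrow>
      (\<integral>\<^sup>+ y. Lp_energy p lamH (\<lambda>h. transfer f y h - transfer f y (h + k)) \<partial>\<nu>H) \<le> ennreal M * G.energy p f"
    by (rule nn_integral_transfer_bounded_le) blast
  define w where "w = measure lamH (mcball_of dH 0 r)"
  have w: "emeasure lamH (mcball_of dH 0 r) = ennreal w" "w \<ge> 0"
    using H.emeasure_mcball[of 0 r] unfolding w_def by (auto intro!: emeasure_eq_ennreal_measure)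
  obtain V where V: "emeasure \<nu>G FG = ennreal V" "V > 0"
    using emeasure_\<nu>G by (cases "emeasure \<nu>G FG") (auto simp: less_le)
  define b where "b = c * (w * M)"
  have b: "b \<ge> 0" using c w M by (simp add: b_def)
  \<comment> \<open>\<open>b\<close> multiplies the averaging constant, the mass of the ball
    averaged over and the bound for single translates; \<open>V\<close> is the factor by which
    lifting multiplies the norm. The added 1 keeps the constant positive when
    \<open>b = 0\<close>.\<close>
  have K: "(b + 1) / V > 0" using b V by simp
  show ?thesis
  proof (rule that[OF K])
    fix f :: "'g \<Rightarrow> real"
    assume f [measurable]: "f \<in> borel_measurable borel" and nz: "Lp_energy p lamG f \<noteq> 0"
      and fin: "Lp_energy p lamG f < \<infinity>"
    define D where "D y u = Lp_energy p lamH (\<lambda>h. transfer f y h - transfer f y (h + u))" for y u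
    have [measurable]: "case_prod D \<in> borel_measurable (\<nu>H \<Otimes>\<^sub>M lamH)"
      unfolding D_def Lp_energy_def by measurable
    have [measurable]: "(\<lambda>(u, y). D y u) \<in> borel_measurable (lamH \<Otimes>\<^sub>M \<nu>H)"
      unfolding D_def Lp_energy_def by measurable
    define \<Phi> where "\<Phi> y = ennreal c * (\<integral>\<^sup>+ u. indicator (mcball_of dH 0 r) u * D y u \<partial>lamH)" for y
    define N where "N y = Lp_energy p lamH (transfer f y)" for y
    have [measurable]: "\<Phi> \<in> borel_measurable \<nu>H" unfolding \<Phi>_def by measurable
    have [measurable]: "N \<in> borel_measurable \<nu>H" unfolding N_def Lp_energy_def by measurable
    have Efin: "G.energy p f < \<infinity>"
      using G.energy_le[OF p f] fin by (auto intro: le_less_trans simp: ennreal_mult_less_top)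
    have "(\<integral>\<^sup>+ y. \<Phi> y \<partial>\<nu>H) = ennreal c * (\<integral>\<^sup>+ y. \<integral>\<^sup>+ u. indicator (mcball_of dH 0 r) u * D y u \<partial>lamH \<partial>\<nu>H)"
      unfolding \<Phi>_def by (intro nn_integral_cmult) measurable
    also have "(\<integral>\<^sup>+ y. \<integral>\<^sup>+ u. indicator (mcball_of dH 0 r) u * D y u \<partial>lamH \<partial>\<nu>H)
        = (\<integral>\<^sup>+ u. \<integral>\<^sup>+ y. indicator (mcball_of dH 0 r) u * D y u \<partial>\<nu>H \<partial>lamH)"
      by (rule P.Fubini') measurable
    finally have \<Phi>1: "(\<integral>\<^sup>+ y. \<Phi> y \<partial>\<nu>H)
      = ennreal c * (\<integral>\<^sup>+ u. \<integral>\<^sup>+ y. indicator (mcball_of dH 0 r) u * D y u \<partial>\<nu>H \<partial>lamH)" .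
    have "(\<integral>\<^sup>+ u. \<integral>\<^sup>+ y. indicator (mcball_of dH 0 r) u * D y u \<partial>\<nu>H \<partial>lamH)
        \<le> (\<integral>\<^sup>+ u. (ennreal M * G.energy p f) * indicator (mcball_of dH 0 r) u \<partial>lamH)"
    proof (intro nn_integral_mono)
      fix u
      show "(\<integral>\<^sup>+ y. indicator (mcball_of dH 0 r) u * D y u \<partial>\<nu>H)
          \<le> (ennreal M * G.energy p f) * indicator (mcball_of dH 0 r) u"
        using M(2)[OF f, of u] by (cases "mdist dH 0 u \<le> r") (auto simp: D_def)
    qed
    also have "\<dots> = ennreal M * G.energy p f * ennreal w"
      by (simp add: nn_integral_cmult_indicator w)
    finally have "(\<integral>\<^sup>+ y. \<Phi> y \<partial>\<nu>H) \<le> ennreal c * (ennreal M * G.energy p f * ennreal w)"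
      unfolding \<Phi>1 by (intro mult_left_mono) auto
    also have "\<dots> = ennreal b * G.energy p f"
      using c M w by (simp add: b_def ennreal_mult mult_ac)
    finally have \<Phi>: "(\<integral>\<^sup>+ y. \<Phi> y \<partial>\<nu>H) \<le> ennreal b * G.energy p f" .
    have "\<exists>y\<in>space \<nu>H. N y \<noteq> 0 \<and> N y < \<infinity> \<and>
        \<Phi> y * (Lp_energy p lamG f * emeasure \<nu>G FG) \<le> (ennreal b * G.energy p f) * N y"
    proof (rule ex_point_ratio_le)
      show "(\<integral>\<^sup>+ y. N y \<partial>\<nu>H) = Lp_energy p lamG f * emeasure \<nu>G FG"
        unfolding N_def by (rule nn_integral_Lp_energy_transfer[OF f])
    qed (use nz fin \<Phi> Efin V in \<open>auto simp: ennreal_mult_less_top\<close>)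
    then obtain y where y: "y \<in> FH" "N y \<noteq> 0" "N y < \<infinity>"
      and le: "\<Phi> y * (Lp_energy p lamG f * ennreal V) \<le> (ennreal b * G.energy p f) * N y"
      by (auto simp: V(1))
    have "H.energy p (transfer f y) \<le> \<Phi> y"
      unfolding \<Phi>_def D_def using y FH by (intro avg transfer_measurable') auto
    then have "H.energy p (transfer f y) * Lp_energy p lamG f \<le> \<Phi> y * Lp_energy p lamG f"
      by (rule mult_right_mono) simp
    also have "\<dots> = ennreal (1 / V) * (\<Phi> y * (Lp_energy p lamG f * ennreal V))"
    proof -
      have "ennreal (1 / V) * ennreal V = 1" using V by (simp flip: ennreal_mult)
      then have "\<Phi> y * Lp_energy p lamG f = ennreal (1 / V) * ennreal V * (\<Phi> y * Lp_energy p lamG f)" by simp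
      also have "\<dots> = ennreal (1 / V) * (\<Phi> y * (Lp_energy p lamG f * ennreal V))" by (simp only: mult_ac)
      finally show ?thesis .
    qed
    also have "\<dots> \<le> ennreal (1 / V) * ((ennreal b * G.energy p f) * N y)"
      by (intro mult_left_mono le) simp
    also have "\<dots> = ennreal (b / V) * G.energy p f * N y"
    proof -
      have "ennreal (b / V) = ennreal (1 / V) * ennreal b" using V b by (simp flip: ennreal_mult)
      then show ?thesis by (simp only: mult_ac)
    qed
    also have "\<dots> \<le> ennreal ((b + 1) / V) * G.energy p f * N y"
      using V by (intro mult_right_mono ennreal_leI divide_right_mono) auto
    finally show "\<exists>y\<in>FH. Lp_energy p lamH (transfer f y) \<noteq> 0 \<and> Lp_energy p lamH (transfer f y) < \<infinity> \<and>
        H.energy p (transfer f y) * Lp_energy p lamG f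
          \<le> ennreal ((b + 1) / V) * G.energy p f * Lp_energy p lamH (transfer f y)"
      using y by (auto simp: N_def)
  qed
qed

text \<open>The coarse \<open>m\<close>-to-one condition concerns base points in \<open>FG\<close>,
  so \<open>y\<close> is first written as \<open>proj y\<close> acting on some \<open>x\<close> in
  \<open>FG\<close>. Then \<open>transfer f y h\<close> evaluates \<open>f\<close> at
  \<open>proj y\<close> times the cocycle of \<open>- h\<close> at \<open>x\<close>. Left invariance
  of \<open>dG\<close> moves the balls around \<open>Z\<close> to balls of the same radius 3, whose
  preimages are each covered by \<open>m\<close> balls of radius \<open>s\<close>.\<close>

lemma transfer_support:
  assumes coarse: "coarsely_m_to_one m s dH dG actH actG FG"
    and [measurable]: "f \<in> borel_measurable borel" and y: "y \<in> FH"
    and Z: "finite Z" "\<And>x. f x \<noteq> 0 \<Longrightarrow> \<exists>z\<in>Z. mdist dG z x < 3"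
  shows "emeasure lamH {h. transfer f y h \<noteq> 0} \<le> ennreal (real (card Z) * (real m * measure lamH (mball_of dH 0 s)))"
proof -
  define \<beta> where "\<beta> = measure lamH (mball_of dH 0 s)"
  have \<beta>: "emeasure lamH (mball_of dH w s) = ennreal \<beta>" for w
    using H.emeasure_mball[of 0 s] unfolding \<beta>_def H.emeasure_mball_eq[of w]
    by (intro emeasure_eq_ennreal_measure) auto
  have "y \<in> space \<mu>" using y FH by auto
  then obtain x where x: "x \<in> FG" "y = actG (proj y) x" using ex_representation by blast
  have "\<forall>g. \<exists>W. finite W \<and> card W \<le> m \<and>
      {h. cocycle actH actG FG (- h) x \<in> mball_of dG g 3} \<subseteq> (\<Union>w\<in>W. mball_of dH w s)"
    using coarse x(1) by (simp add: coarsely_m_to_one_def)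
  then obtain W where W: "\<And>g. finite (W g)" "\<And>g. card (W g) \<le> m"
    "\<And>g. {h. cocycle actH actG FG (- h) x \<in> mball_of dG g 3} \<subseteq> (\<Union>w\<in>W g. mball_of dH w s)"
    by metis
  have tr: "transfer f y h = f (proj y + cocycle actH actG FG (- h) x)" for h
    unfolding transfer_def
    by (subst x(2)) (use x(1) FG in \<open>auto simp: act_commute proj_actG actH_space cocycle_eq\<close>)
  have "{h. transfer f y h \<noteq> 0} \<subseteq> (\<Union>z\<in>Z. \<Union>w\<in>W (- proj y + z). mball_of dH w s)"
  proof
    fix h assume "h \<in> {h. transfer f y h \<noteq> 0}"
    then obtain z where z: "z \<in> Z" "mdist dG z (proj y + cocycle actH actG FG (- h) x) < 3"
      using Z(2) by (auto simp: tr)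
    have "mdist dG (- proj y + z) (cocycle actH actG FG (- h) x)
        = mdist dG (proj y + (- proj y + z)) (proj y + cocycle actH actG FG (- h) x)"
      by (rule G.dist_left[symmetric])
    then have "cocycle actH actG FG (- h) x \<in> mball_of dG (- proj y + z) 3"
      using z by (simp add: add.assoc[symmetric])
    then show "h \<in> (\<Union>z\<in>Z. \<Union>w\<in>W (- proj y + z). mball_of dH w s)" using W(3) z(1) by blast
  qed
  then have "emeasure lamH {h. transfer f y h \<noteq> 0}
      \<le> emeasure lamH (\<Union>z\<in>Z. \<Union>w\<in>W (- proj y + z). mball_of dH w s)"
    by (intro emeasure_mono) (use Z W in \<open>auto intro!: sets.finite_UN\<close>)
  also have "\<dots> \<le> (\<Sum>z\<in>Z. emeasure lamH (\<Union>w\<in>W (- proj y + z). mball_of dH w s))"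
    by (intro emeasure_subadditive_finite) (use Z W in \<open>auto intro!: sets.finite_UN\<close>)
  also have "\<dots> \<le> (\<Sum>z\<in>Z. ennreal (real m * \<beta>))"
  proof (intro sum_mono)
    fix z
    have "emeasure lamH (\<Union>w\<in>W (- proj y + z). mball_of dH w s)
        \<le> (\<Sum>w\<in>W (- proj y + z). emeasure lamH (mball_of dH w s))"
      by (intro emeasure_subadditive_finite) (use W in auto)
    also have "\<dots> = ennreal (real (card (W (- proj y + z))) * \<beta>)"
      by (simp add: \<beta> ennreal_mult \<beta>_def ennreal_of_nat_eq_real_of_nat)
    also have "\<dots> \<le> ennreal (real m * \<beta>)"
      using W(2) by (intro ennreal_leI mult_right_mono) (auto simp: \<beta>_def)
    finally show "emeasure lamH (\<Union>w\<in>W (- proj y + z). mball_of dH w s) \<le> ennreal (real m * \<beta>)" .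
  qed
  also have "\<dots> = ennreal (real (card Z) * (real m * \<beta>))"
    by (simp add: \<beta>_def ennreal_mult ennreal_of_nat_eq_real_of_nat)
  finally show ?thesis by (simp add: \<beta>_def)
qed

section \<open>Comparison of the profiles\<close>

theorem isop_profile_dominated:
  assumes coarse: "coarsely_m_to_one m s dH dG actH actG FG"
  shows "asymp_dominated (isop_profile p SG lamG) (isop_profile p SH lamH)"
proof -
  obtain c c' :: real where c: "c > 0" "c' > 0" and thick:
    "\<And>f A v. f \<in> borel_measurable borel \<Longrightarrow> Lp_energy p lamG f < \<infinity> \<Longrightarrow> A \<in> sets borel \<Longrightarrow>
      emeasure lamG A \<le> ennreal v \<Longrightarrow> 0 \<le> v \<Longrightarrow> (\<And>x. x \<notin> A \<Longrightarrow> f x = 0) \<Longrightarrow>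
      ennreal c * G.energy p f \<le> Lp_energy p lamG f \<Longrightarrow>
      \<exists>f' Z. f' \<in> borel_measurable borel \<and> Lp_energy p lamG f' < \<infinity> \<and>
        Lp_energy p lamG f \<le> ennreal c' * Lp_energy p lamG f' \<and> G.energy p f' \<le> ennreal c' * G.energy p f \<and>
        finite Z \<and> real (card Z) \<le> 2 * v / measure lamG (mball_of dG 0 1) \<and>
        (\<forall>x. f' x \<noteq> 0 \<longrightarrow> (\<exists>z\<in>Z. mdist dG z x < 3))"
    by (rule G.thick_support[OF p]) blast
  obtain K where K: "K > 0" and good: "\<And>f. f \<in> borel_measurable borel \<Longrightarrow> Lp_energy p lamG f \<noteq> 0 \<Longrightarrow>
      Lp_energy p lamG f < \<infinity> \<Longrightarrow>
      \<exists>y\<in>FH. Lp_energy p lamH (transfer f y) \<noteq> 0 \<and> Lp_energy p lamH (transfer f y) < \<infinity> \<and>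
        H.energy p (transfer f y) * Lp_energy p lamG f \<le> ennreal K * G.energy p f * Lp_energy p lamH (transfer f y)"
    by (rule ex_good_transfer) blast
  obtain c0 v0 where c0: "c0 > 0" and pos: "\<And>v. v \<ge> v0 \<Longrightarrow> ennreal c0 \<le> isop_profile p SH lamH v"
    using H.isop_profile_pos[OF p] by blast
  define \<beta> where "\<beta> = real m * measure lamH (mball_of dH 0 s)"
  define b where "b = measure lamG (mball_of dG 0 1)"
  have \<beta>: "\<beta> \<ge> 0" by (simp add: \<beta>_def)
  have b: "b \<ge> 0" by (simp add: b_def)
  \<comment> \<open>The first summand turns \<open>v\<close> into the support bound: at most
    \<open>2 * v / b\<close> balls of radius 3, each costing \<open>\<beta>\<close> in
    \<open>H\<close>. The added 1 ensures \<open>C * v \<ge> v\<close>, so the lower bound for the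
    profile of \<open>H\<close> is available at \<open>C * v\<close>.\<close>
  define C where "C = 2 * \<beta> / b + 1"
  have C: "C \<ge> 1" using \<beta> b by (simp add: C_def)
  \<comment> \<open>One factor \<open>c'\<close> pays for the norm lost in the cutoff, the other for
    the gradient gained, and \<open>K\<close> for the choice of \<open>y\<close>. In
    \<open>K'\<close> below, each summand settles one case: functions that survive the cutoff, and
    functions with large gradient.\<close>
  define K2 where "K2 = c' * K * c'"
  have K2: "K2 > 0" using K c by (simp add: K2_def)
  define K' where "K' = K2 powr (1 / p) + c powr (1 / p) / c0"
  have K': "K' > 0" using K2 c c0 by (auto simp: K'_def intro!: add_pos_pos)
  have main: "isop_profile p SG lamG v \<le> ennreal K' * isop_profile p SH lamH (C * v)" if v: "v \<ge> max 0 v0" for v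
  proof (rule G.isop_profile_le[OF p])
    fix f A
    assume f [measurable]: "f \<in> borel_measurable borel" and fin: "Lp_energy p lamG f < \<infinity>"
      and nz: "Lp_energy p lamG f \<noteq> 0" and A: "A \<in> sets borel" "emeasure lamG A \<le> ennreal v"
      and fA: "\<And>x. x \<notin> A \<Longrightarrow> f x = 0"
    define X where "X = Lp_energy p lamG f"
    define Q where "Q = G.energy p f"
    have Q: "Q < \<infinity>"
      using G.energy_le[OF p f] fin by (auto simp: Q_def intro: le_less_trans simp: ennreal_mult_less_top)
    have "v \<le> C * v" using C v by (simp add: mult_le_cancel_right1)
    then have Cv: "C * v \<ge> v0" using v by simp
    have "epowr (1 / p) (X / Q) \<le> ennreal K' * isop_profile p SH lamH (C * v)"
    proof (cases "ennreal c * Q \<le> X")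
      case True
      then obtain f' Z where f' [measurable]: "f' \<in> borel_measurable borel" and fin': "Lp_energy p lamG f' < \<infinity>"
        and XX': "X \<le> ennreal c' * Lp_energy p lamG f'" and QQ': "G.energy p f' \<le> ennreal c' * Q"
        and Z: "finite Z" "real (card Z) \<le> 2 * v / b" "\<And>x. f' x \<noteq> 0 \<Longrightarrow> \<exists>z\<in>Z. mdist dG z x < 3"
        using thick[OF f fin A _ fA] v unfolding X_def Q_def b_def by auto
      have "Lp_energy p lamG f' \<noteq> 0" using XX' nz by (auto simp: X_def)
      then obtain y where y: "y \<in> FH" "Lp_energy p lamH (transfer f' y) \<noteq> 0" "Lp_energy p lamH (transfer f' y) < \<infinity>"
        and le: "H.energy p (transfer f' y) * Lp_energy p lamG f'
          \<le> ennreal K * G.energy p f' * Lp_energy p lamH (transfer f' y)"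
        using good[OF f' _ fin'] by blast
      define N where "N = Lp_energy p lamH (transfer f' y)"
      define E where "E = H.energy p (transfer f' y)"
      have "E * X \<le> E * (ennreal c' * Lp_energy p lamG f')" by (intro mult_left_mono XX') simp
      also have "\<dots> = ennreal c' * (E * Lp_energy p lamG f')" by (simp only: mult_ac)
      also have "\<dots> \<le> ennreal c' * (ennreal K * G.energy p f' * N)"
        using le by (intro mult_left_mono) (auto simp: E_def N_def)
      also have "\<dots> \<le> ennreal c' * (ennreal K * (ennreal c' * Q) * N)"
        using QQ' by (intro mult_left_mono mult_right_mono) auto
      also have "\<dots> = ennreal K2 * Q * N"
        using c K by (simp add: K2_def ennreal_mult mult_ac)
      finally have "E * X \<le> ennreal K2 * Q * N" .
      then have "X / Q \<le> ennreal K2 * (N / E)"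
        by (intro ennreal_ratio_le) (use nz fin y Q K2 in \<open>auto simp: X_def N_def\<close>)
      then have "epowr (1 / p) (X / Q) \<le> epowr (1 / p) (ennreal K2 * (N / E))"
        using p by (intro epowr_mono) auto
      also have "\<dots> = ennreal (K2 powr (1 / p)) * epowr (1 / p) (N / E)"
        by (rule epowr_mult[OF K2])
      also have "epowr (1 / p) (N / E) \<le> isop_profile p SH lamH (C * v)"
        unfolding N_def E_def
      proof (rule H.isop_profile_ge[OF p])
        have y': "y \<in> space \<mu>" using y FH by auto
        show [measurable]: "transfer f' y \<in> borel_measurable borel" using y' by (intro transfer_measurable' f')
        show "{h. transfer f' y h \<noteq> 0} \<in> sets borel" by measurable
        have "emeasure lamH {h. transfer f' y h \<noteq> 0} \<le> ennreal (real (card Z) * \<beta>)"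
          unfolding \<beta>_def by (rule transfer_support[OF coarse f' y(1) Z(1) Z(3)])
        also have "real (card Z) * \<beta> \<le> 2 * v / b * \<beta>" by (intro mult_right_mono Z \<beta>)
        also have "\<dots> \<le> C * v" using v by (simp add: C_def algebra_simps)
        finally show "emeasure lamH {h. transfer f' y h \<noteq> 0} \<le> ennreal (C * v)" by (simp add: ennreal_leI)
      qed (use y in auto)
      finally have "epowr (1 / p) (X / Q) \<le> ennreal (K2 powr (1 / p)) * isop_profile p SH lamH (C * v)"
        by (simp add: mult_left_mono)
      also have "\<dots> \<le> ennreal K' * isop_profile p SH lamH (C * v)"
        using c c0 by (intro mult_right_mono ennreal_leI) (auto simp: K'_def)
      finally show ?thesis .
    next
      case False
      \<comment> \<open>The gradient is too large for the cutoff, but the ratio is then at most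
        \<open>c\<close>, which a fixed multiple of the lower bound \<open>c0\<close> for the
        profile of \<open>H\<close> dominates.\<close>
      then have "X / Q \<le> ennreal c * (1 / 1)"
        by (intro ennreal_ratio_le) (use nz fin Q c in \<open>auto simp: X_def\<close>)
      then have "epowr (1 / p) (X / Q) \<le> epowr (1 / p) (ennreal c)"
        using p by (intro epowr_mono) auto
      also have "\<dots> = ennreal (c powr (1 / p) / c0) * ennreal c0"
        using c c0 by (simp add: epowr_ennreal flip: ennreal_mult)
      also have "\<dots> \<le> ennreal K' * isop_profile p SH lamH (C * v)"
        using K2 by (intro mult_mono ennreal_leI pos Cv) (auto simp: K'_def)
      finally show ?thesis .
    qed
    then show "epowr (1 / p) (Lp_energy p lamG f / G.energy p f) \<le> ennreal K' * isop_profile p SH lamH (C * v)"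
      by (simp add: X_def Q_def)
  qed
  show ?thesis
    unfolding asymp_dominated_def
  proof (intro exI conjI)
    show "C > 0" using C by simp
    show "K' > 0" by (rule K')
    show "\<forall>\<^sub>F v in at_top. isop_profile p SG lamG v \<le> ennreal K' * isop_profile p SH lamH (C * v)"
      using eventually_ge_at_top[of "max 0 v0"] by eventually_elim (rule main)
  qed
qed

end

theorem theorem2:
  fixes SH :: "'h::{topological_group_add, t2_space, second_countable_topology} set"
    and SG :: "'g::{topological_group_add, t2_space, second_countable_topology} set"
    and dH :: "'h metric" and dG :: "'g metric"
    and lamH :: "'h measure" and lamG :: "'g measure"
    and s p :: real and m :: nat
    and \<mu> :: "'a measure"
    and actH :: "'h \<Rightarrow> 'a \<Rightarrow> 'a" and actG :: "'g \<Rightarrow> 'a \<Rightarrow> 'a"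
    and FH FG :: "'a set" and \<nu>H \<nu>G :: "'a measure"
  assumes "locally_compact_space (euclidean :: 'h topology)"
    and "locally_compact_space (euclidean :: 'g topology)"
    and "compact_symmetric_generating SH" and "compact_symmetric_generating SG"
    and "adapted_metric SH dH" and "adapted_metric SG dG"
    and "haar_measure lamH" and "haar_measure lamG"
    and "unimodular TYPE('h)" and "unimodular TYPE('g)"
    and "s > 0" and "1 \<le> p" and "m > 0"
    and "measure_subgroup_coupling lamH lamG \<mu> actH actG FH FG \<nu>H \<nu>G"
    and "Lp_coupling p SH SG actH actG FG \<nu>G"
    and "coarsely_m_to_one m s dH dG actH actG FG"
  shows "asymp_dominated (isop_profile p SG lamG) (isop_profile p SH lamH)"
proof -
  interpret subgroup_coupling SH dH lamH SG dG lamG p \<mu> actH actG FH FG \<nu>H \<nu>G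
    by unfold_locales (use assms in auto)
  show ?thesis by (rule isop_profile_dominated) fact
qed

end
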